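(* Let $K$ be a compact Hausdorff space, let $\alpha\in\omega_1$ be a countable ordinal, and let the scalar field be $\mathbb{R}$. If the Cantor--Bendixson derived set $K^{(\alpha\odot 2)}$ is nonempty, then there exists a $3$-SPR isometric embedding of $C[1,\omega^\alpha]$ into $C(K)$, i.e. a linear isometric embedding $T:C[1,\omega^\alpha]\to C(K)$ whose range does $3$-SPR in $C(K)$.
   Context: $C(K)$ is the space of real-valued continuous functions on $K$ with the supremum norm. A linear subspace $E$ of $C(K)$ does $C$-stable phase retrieval ($C$-SPR), for a constant $C\ge1$, if $\min\{\|f-g\|,\|f+g\|\}\le C\,\big\||f|-|g|\big\|$ for all $f,g\in E$. Cantor--Bendixson derivatives: for a topological space $T$, $T'$ is the set of its non-isolated points; $K^{(0)}=K$, $K^{(\alpha+1)}=(K^{(\alpha)})'$ (with $K^{(\alpha)}$ in the subspace topology), and $K^{(\alpha)}=\bigcap_{\beta<\alpha}K^{(\beta)}$ for limit ordinals $\alpha$. Ordinals: $\omega_1$ is the first uncountable ordinal and ordinal powers are ordinal exponentiation. $[1,\omega^\alpha]$ is the set of ordinals $\beta$ with $1\le\beta\le\omega^\alpha$ with the order topology (a compact Hausdorff space). For ordinals $\alpha,\beta$, $\alpha\oplus\beta$ is the natural (Hessenberg) sum, i.e. the ordinal whose Cantor normal form is obtained by adding coordinatewise the coefficients of the Cantor normal forms of $\alpha$ and $\beta$; and $\alpha\odot 2=\alpha\oplus\alpha$, i.e. if $\alpha=\omega^{\beta_1}\cdot k_1+\dots+\omega^{\beta_n}\cdot k_n$ with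 $\beta_1>\dots>\beta_n$ and positive integers $k_i$, then $\alpha\odot2=\omega^{\beta_1}\cdot 2k_1+\dots+\omega^{\beta_n}\cdot 2k_n$ (and $0\odot 2=0$). *)

theory Defs
  imports "HOL-Analysis.Analysis" "HOL-Library.Countable_Set_Type" "HOL-Library.Poly_Mapping"
begin

section \<open>The countable ordinals\<close>

text \<open>
  The cardinal successor of \<open>natLeq\<close> is the initial ordinal \<open>\<omega>\<^sub>1\<close>, presented as a well-order on a
  set of sets of naturals. The elements of its field, ordered by it, are exactly the countable
  ordinals (see \<open>countable_below\<close> and \<open>countable_strictly_bounded\<close>).
\<close>

lemma Card_order_omega1: "Card_order (cardSuc natLeq)"
  by (rule cardSuc_Card_order[OF natLeq_Card_order])

lemma Well_order_omega1: "Well_order (cardSuc natLeq)"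
  using Card_order_omega1 card_order_on_well_order_on by blast

lemma infinite_Field_omega1: "infinite (Field (cardSuc natLeq))"
  by (simp add: Field_natLeq cardSuc_finite[OF natLeq_Card_order])

typedef omega1 = "Field (cardSuc natLeq)"
  using infinite_imp_nonempty[OF infinite_Field_omega1] by blast

instantiation omega1 :: wellorder
begin

definition less_eq_omega1 :: "omega1 \<Rightarrow> omega1 \<Rightarrow> bool"
  where "(x :: omega1) \<le> y \<longleftrightarrow> (Rep_omega1 x, Rep_omega1 y) \<in> cardSuc natLeq"

definition less_omega1 :: "omega1 \<Rightarrow> omega1 \<Rightarrow> bool"
  where "(x :: omega1) < y \<longleftrightarrow> x \<le> y \<and> x \<noteq> y"

instance
proof
  let ?r = "cardSuc natLeq"
  have refl: "refl_on (Field ?r) ?r" and trans: "trans ?r" and anti: "antisym ?r"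
    and total: "total_on (Field ?r) ?r" and wf: "wf (?r - Id)"
    using Well_order_omega1
    unfolding well_order_on_def linear_order_on_def partial_order_on_def preorder_on_def by blast+
  show refl': "x \<le> x" for x :: omega1
    using refl Rep_omega1[of x] unfolding less_eq_omega1_def refl_on_def by blast
  show trans': "x \<le> y \<Longrightarrow> y \<le> z \<Longrightarrow> x \<le> z" for x y z :: omega1
    using trans unfolding less_eq_omega1_def trans_def by blast
  show anti': "x \<le> y \<Longrightarrow> y \<le> x \<Longrightarrow> x = y" for x y :: omega1
    using antisymD[OF anti, of "Rep_omega1 x" "Rep_omega1 y"]
    unfolding less_eq_omega1_def Rep_omega1_inject by blast
  show "x < y \<longleftrightarrow> x \<le> y \<and> \<not> y \<le> x" for x y :: omega1
    using anti' refl' unfolding less_omega1_def by blast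
  show "x \<le> y \<or> y \<le> x" for x y :: omega1
  proof (cases "x = y")
    case False
    then have "Rep_omega1 x \<noteq> Rep_omega1 y"
      by (simp add: Rep_omega1_inject)
    then show ?thesis
      using total Rep_omega1[of x] Rep_omega1[of y]
      unfolding less_eq_omega1_def total_on_def by blast
  qed (simp add: refl')
  show "P a" if step: "\<And>x. (\<And>y. y < x \<Longrightarrow> P y) \<Longrightarrow> P x" for P and a :: omega1
  proof -
    have "wf (inv_image (?r - Id) Rep_omega1)"
      using wf by (rule wf_inv_image)
    then show ?thesis
    proof (induction a rule: wf_induct_rule)
      case (less x)
      show ?case
      proof (rule step)
        fix y :: omega1
        assume "y < x"
        then show "P y"
          by (intro less) (simp add: less_omega1_def less_eq_omega1_def Rep_omega1_inject)
      qed
    qed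
  qed
qed

end

text \<open>The order topology, on all of \<open>\<omega>\<^sub>1\<close>.\<close>

instantiation omega1 :: linorder_topology
begin

definition open_omega1 :: "omega1 set \<Rightarrow> bool"
  where "open_omega1 = generate_topology (range lessThan \<union> range greaterThan)"

instance
  by standard (simp add: open_omega1_def)

end

lemma countable_below:
  includes cardinal_syntax
  shows "countable {..<a :: omega1}"
proof -
  let ?U = "underS (cardSuc natLeq) (Rep_omega1 a)"
  have "|?U| <o cardSuc natLeq"
    by (rule card_of_underS[OF Card_order_omega1 Rep_omega1])
  then have "|?U| \<le>o natLeq"
    using cardSuc_ordLeq_ordLess[OF natLeq_Card_order card_of_Card_order] by blast
  then have "countable ?U"
    by (simp add: countable_card_le_natLeq)
  moreover have "Rep_omega1 ` {..<a} \<subseteq> ?U"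
    by (auto simp: underS_def less_omega1_def less_eq_omega1_def Rep_omega1_inject)
  ultimately have "countable (Rep_omega1 ` {..<a})"
    by (rule countable_subset[rotated])
  then show ?thesis
    by (rule countable_image_inj_on) (simp add: inj_on_def Rep_omega1_inject)
qed

lemma countable_strictly_bounded:
  includes cardinal_syntax
  fixes A :: "omega1 set"
  assumes "countable A"
  shows "\<exists>u. \<forall>a\<in>A. a < u"
proof (rule ccontr)
  assume "\<not> ?thesis"
  then have "\<exists>a\<in>A. u \<le> a" for u
    by (auto simp: not_less)
  then have "UNIV = (\<Union>a\<in>A. insert a {..<a})"
    by (auto simp: le_less)
  moreover have "countable (\<Union>a\<in>A. insert a {..<a})"
    using assms countable_below by (intro countable_UN) auto
  ultimately have "countable (UNIV :: omega1 set)"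
    by simp
  then have "countable (range Rep_omega1)"
    by (rule countable_image)
  then have "countable (Field (cardSuc natLeq))"
    using type_definition.Rep_range[OF type_definition_omega1] by simp
  then have "|Field (cardSuc natLeq)| \<le>o natLeq"
    by (simp add: countable_card_le_natLeq)
  then have "cardSuc natLeq \<le>o natLeq"
    using card_of_Field_ordIso[OF Card_order_omega1] ordIso_symmetric ordIso_ordLeq_trans by blast
  then show False
    using cardSuc_greater[OF natLeq_Card_order] not_ordLess_ordLeq by blast
qed


section \<open>Ordinal arithmetic\<close>

instantiation omega1 :: zero
begin
definition zero_omega1 :: omega1 where "(0 :: omega1) = (LEAST x. True)"
instance ..
end

definition osuc :: "omega1 \<Rightarrow> omega1"
  where "osuc a = (LEAST b. a < b)"

text \<open>The supremum of a set of ordinals; \<open>\<omega>\<^sub>1\<close> has suprema of countable sets only.\<close>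

definition osup :: "omega1 set \<Rightarrow> omega1"
  where "osup A = (LEAST u. \<forall>a\<in>A. a \<le> u)"

text \<open>
  Transfinite recursion: the value at \<open>0\<close> is \<open>z\<close>, the value at a successor is obtained by
  applying \<open>s\<close> to the value at the predecessor, and the value at a limit ordinal is
  obtained by applying \<open>l\<close> to the set of all earlier values.
\<close>

function trec :: "'b \<Rightarrow> ('b \<Rightarrow> 'b) \<Rightarrow> ('b set \<Rightarrow> 'b) \<Rightarrow> omega1 \<Rightarrow> 'b" where
  "trec z s l a =
    (if a = 0 then z
     else if \<exists>b<a. a = osuc b then s (trec z s l (SOME b. b < a \<and> a = osuc b))
     else l (trec z s l ` {..<a}))"
  by pat_completeness auto
termination
proof (relation "inv_image {(x, y). x < y} (\<lambda>(z, s, l, a). a)")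
  show "wf (inv_image {(x :: omega1, y). x < y} (\<lambda>(z, s, l, a). a))"
    by (intro wf_inv_image wf)
next
  fix z :: 'b and s l and a :: omega1
  assume "\<exists>b<a. a = osuc b"
  then have "(SOME b. b < a \<and> a = osuc b) < a"
    by (metis (mono_tags, lifting) someI_ex)
  then show "((z, s, l, SOME b. b < a \<and> a = osuc b), (z, s, l, a))
      \<in> inv_image {(x, y). x < y} (\<lambda>(z, s, l, a). a)"
    by simp
qed auto

declare trec.simps [simp del]

instantiation omega1 :: "{one, plus, times}"
begin

definition one_omega1 :: omega1
  where "(1 :: omega1) = osuc 0"

definition plus_omega1 :: "omega1 \<Rightarrow> omega1 \<Rightarrow> omega1"
  where "(a :: omega1) + b = trec a osuc osup b"

definition times_omega1 :: "omega1 \<Rightarrow> omega1 \<Rightarrow> omega1"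
  where "(a :: omega1) * b = trec 0 (\<lambda>u. u + a) osup b"

instance ..

end

definition fin_ord :: "nat \<Rightarrow> omega1"
  where "fin_ord n = (osuc ^^ n) 0"

definition omega :: omega1  (\<open>\<omega>\<close>)
  where "\<omega> = osup (range fin_ord)"

definition oexp :: "omega1 \<Rightarrow> omega1 \<Rightarrow> omega1"
  where "oexp a b = trec 1 (\<lambda>u. u * a) osup b"

lemma osuc_greater: "a < osuc a"
proof -
  have "\<exists>b. a < b"
    using countable_strictly_bounded[of "{a}"] by simp
  then show ?thesis
    unfolding osuc_def by (rule LeastI_ex)
qed

lemma osuc_le_iff: "osuc a \<le> b \<longleftrightarrow> a < b"
proof
  show "osuc a \<le> b \<Longrightarrow> a < b"
    using osuc_greater[of a] by (rule order_less_le_trans)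
  show "a < b \<Longrightarrow> osuc a \<le> b"
    unfolding osuc_def by (rule Least_le)
qed

lemma osuc_inject: "osuc a = osuc b \<longleftrightarrow> a = b"
proof
  assume eq: "osuc a = osuc b"
  have "a \<le> b" if "osuc a = osuc b" for a b
    using osuc_le_iff[of b a] osuc_greater[of a] that by (metis not_le)
  from this[OF eq] this[OF eq[symmetric]] show "a = b" by (rule antisym)
qed simp

lemma zero_le_omega1: "(0 :: omega1) \<le> a"
  unfolding zero_omega1_def by (rule Least_le) simp

lemma osup_le_iff:
  assumes "countable A"
  shows "osup A \<le> b \<longleftrightarrow> (\<forall>a\<in>A. a \<le> b)"
proof
  have "\<exists>u. \<forall>a\<in>A. a \<le> u"
    using countable_strictly_bounded[OF assms] less_imp_le by blast
  then have "\<forall>a\<in>A. a \<le> osup A"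
    unfolding osup_def by (rule LeastI_ex)
  then show "osup A \<le> b \<Longrightarrow> \<forall>a\<in>A. a \<le> b"
    using order_trans by blast
  show "\<forall>a\<in>A. a \<le> b \<Longrightarrow> osup A \<le> b"
    unfolding osup_def by (rule Least_le)
qed

definition limit_ord :: "omega1 \<Rightarrow> bool"
  where "limit_ord a \<longleftrightarrow> a \<noteq> 0 \<and> (\<forall>b. a \<noteq> osuc b)"

lemma trec_0: "trec z s l 0 = z"
  by (simp add: trec.simps)

lemma trec_osuc: "trec z s l (osuc a) = s (trec z s l a)"
proof -
  have "(SOME b. b < osuc a \<and> osuc a = osuc b) = a"
    using osuc_greater by (auto simp: osuc_inject)
  moreover have "osuc a \<noteq> 0"
    using osuc_greater[of a] zero_le_omega1[of a] by auto
  ultimately show ?thesis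
    using osuc_greater by (subst trec.simps) auto
qed

lemma trec_limit: "limit_ord a \<Longrightarrow> trec z s l a = l (trec z s l ` {..<a})"
  by (subst trec.simps) (auto simp: limit_ord_def)


section \<open>Cantor normal form and the natural sum\<close>

text \<open>
  A finitely supported family of coefficients \<open>c\<close> represents the ordinal
  \<open>oexp \<omega> \<beta>\<^sub>1 * c \<beta>\<^sub>1 + \<dots> + oexp \<omega> \<beta>\<^sub>n * c \<beta>\<^sub>n\<close>, where \<open>\<beta>\<^sub>1 > \<dots> > \<beta>\<^sub>n\<close> is the support of \<open>c\<close>. By the
  Cantor normal form theorem every ordinal is represented by exactly one such family, so that the
  description in \<open>cnf\<close> is proper. The sum of two families is taken coefficientwise.
\<close>

definition cnf_ord :: "(omega1 \<Rightarrow>\<^sub>0 nat) \<Rightarrow> omega1"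
  where "cnf_ord c =
    foldr (\<lambda>\<beta> u. oexp \<omega> \<beta> * fin_ord (Poly_Mapping.lookup c \<beta>) + u)
      (rev (sorted_list_of_set (Poly_Mapping.keys c))) 0"

definition cnf :: "omega1 \<Rightarrow> (omega1 \<Rightarrow>\<^sub>0 nat)"
  where "cnf a = (THE c. cnf_ord c = a)"

definition hessenberg_sum :: "omega1 \<Rightarrow> omega1 \<Rightarrow> omega1"
  where "hessenberg_sum a b = cnf_ord (cnf a + cnf b)"

definition hessenberg_double :: "omega1 \<Rightarrow> omega1"
  where "hessenberg_double a = hessenberg_sum a a"


section \<open>Cantor--Bendixson derivatives\<close>

definition non_isolated :: "'k topology \<Rightarrow> 'k set"
  where "non_isolated X = {x \<in> topspace X. \<not> openin X {x}}"

definition CB_derivative :: "'k topology \<Rightarrow> omega1 \<Rightarrow> 'k set"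
  where "CB_derivative X = trec (topspace X) (\<lambda>S. non_isolated (subtopology X S)) Inter"


section \<open>Spaces of continuous functions and stable phase retrieval\<close>

text \<open>
  Functions on the space \<open>X\<close> are total functions on the ambient type normalised to vanish outside
  of \<open>topspace X\<close>, so that equality in \<open>C_space X\<close> is equality on \<open>X\<close>
  and the vector space operations are the pointwise ones. The space \<open>X\<close> will always be compact.
\<close>

definition C_space :: "'k topology \<Rightarrow> ('k \<Rightarrow> real) set"
  where "C_space X = {f. continuous_map X euclideanreal f \<and> (\<forall>x. x \<notin> topspace X \<longrightarrow> f x = 0)}"

text \<open>The inserted \<open>0\<close> only matters when \<open>X\<close> is empty.\<close>

definition sup_norm :: "'k topology \<Rightarrow> ('k \<Rightarrow> real) \<Rightarrow> real"
  where "sup_norm X f = Sup (insert 0 ((\<lambda>x. \<bar>f x\<bar>) ` topspace X))"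

definition C_subspace :: "'k topology \<Rightarrow> ('k \<Rightarrow> real) set \<Rightarrow> bool"
  where "C_subspace X E \<longleftrightarrow>
    E \<subseteq> C_space X \<and> (\<lambda>x. 0) \<in> E \<and>
    (\<forall>f\<in>E. \<forall>g\<in>E. (\<lambda>x. f x + g x) \<in> E) \<and>
    (\<forall>c. \<forall>f\<in>E. (\<lambda>x. c * f x) \<in> E)"

definition does_SPR :: "real \<Rightarrow> 'k topology \<Rightarrow> ('k \<Rightarrow> real) set \<Rightarrow> bool"
  where "does_SPR C X E \<longleftrightarrow>
    C \<ge> 1 \<and> C_subspace X E \<and>
    (\<forall>f\<in>E. \<forall>g\<in>E.
      min (sup_norm X (\<lambda>x. f x - g x)) (sup_norm X (\<lambda>x. f x + g x))
        \<le> C * sup_norm X (\<lambda>x. \<bar>f x\<bar> - \<bar>g x\<bar>))"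

definition linear_isometric_embedding ::
    "'l topology \<Rightarrow> 'k topology \<Rightarrow> (('l \<Rightarrow> real) \<Rightarrow> ('k \<Rightarrow> real)) \<Rightarrow> bool"
  where "linear_isometric_embedding X Y T \<longleftrightarrow>
    T ` C_space X \<subseteq> C_space Y \<and>
    (\<forall>f\<in>C_space X. \<forall>g\<in>C_space X. T (\<lambda>x. f x + g x) = (\<lambda>y. T f y + T g y)) \<and>
    (\<forall>c. \<forall>f\<in>C_space X. T (\<lambda>x. c * f x) = (\<lambda>y. c * T f y)) \<and>
    (\<forall>f\<in>C_space X. sup_norm Y (T f) = sup_norm X f)"

text \<open>
  The subspace topology inherited from \<open>\<omega>\<^sub>1\<close> on the interval \<open>[1, a]\<close> coincides with its own order
  topology, because intervals are order-convex.
\<close>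

definition ord_interval :: "omega1 \<Rightarrow> omega1 topology"
  where "ord_interval a = top_of_set {1..a}"

end

(* If K^(alpha + alpha) (natural sum) is nonempty, then a closed subset of K maps continuously onto
   L x L, where L = [1, omega^alpha]: the point (s, t) of L x L has clopen neighbourhoods in which
   all other points have a smaller rank rho(s) + rho(t) (natural sum), so such a map is built by
   induction on the rank, sending a sequence of disjoint pieces of K accumulating at a point x to
   clopen pieces of L x L that shrink to (s, t). Each coordinate of the map yields a norm one linear
   extension operator: embed L in the real line, extend the coordinate to all of K by Tietze, and
   extend functions on the image of L linearly across its gaps. The average T of the two operators
   satisfies T f = (f(s) + f(t)) / 2 at points over (s, t). As ||a| - |b|| = min(|a - b|, |a + b|),
   stable phase retrieval for T only requires that |T u| and |T v| are simultaneously large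
   somewhere, and the pairs (s, s), (t, t), (s, t) suffice when u peaks at s and v at t. *)
theory Submission
  imports Defs
begin


subsection \<open>Ordinal arithmetic\<close>

text \<open>The rank of a point of L x L has to drop as soon as either coordinate drops in rank. The
  natural sum is strictly increasing in both arguments, while the ordinary sum is not: 0 + \<omega>
  = 1 + \<omega>. The corner of the square receives rank \<open>hessenberg_double \<alpha>\<close>
  and every other point less, so the hypothesis on K is exactly what starts the induction with the
  whole square as target. The obstacle is that K need be neither scattered nor zero-dimensional, so
  it cannot be cut into clopen pieces matching those of the square. The pieces of K are only closed
  sets enclosed in disjoint open sets, and the rest of these open sets is discarded. Hence the map
  lives on a closed subset, and functions must be extended from it. The constant 3 comes from
  balancing two cases. Let |u(s)| and |v(t)| be at least m. If |v(s)| or |u(t)| reaches a threshold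
  x, a diagonal pair gives the bound x; otherwise both averages at (s, t) are at least (m - x) / 2
  in absolute value. The two bounds agree for x = m / 3.\<close>

lemma less_osuc_iff: "a < osuc b \<longleftrightarrow> a \<le> b"
  using osuc_le_iff[of b a] by (metis not_le)

lemma omega1_induct [case_names zero osuc limit]:
  assumes "P 0" and "\<And>a. P a \<Longrightarrow> P (osuc a)"
    and "\<And>a. limit_ord a \<Longrightarrow> (\<And>b. b < a \<Longrightarrow> P b) \<Longrightarrow> P a"
  shows "P a"
proof (induction a rule: less_induct)
  case (less a)
  then show ?case
    using assms osuc_greater unfolding limit_ord_def by metis
qed

lemma not_less_zero [simp]: "\<not> a < (0 :: omega1)"
  using zero_le_omega1[of a] by (simp add: not_less)

lemma zero_less_iff: "0 < a \<longleftrightarrow> a \<noteq> (0 :: omega1)"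
  using zero_le_omega1[of a] by (auto simp: less_le)

lemma limit_ord_osuc_less: "limit_ord a \<Longrightarrow> b < a \<Longrightarrow> osuc b < a"
  unfolding limit_ord_def by (metis less_le osuc_le_iff)

lemma limit_ord_pos: "limit_ord a \<Longrightarrow> 0 < a"
  by (simp add: limit_ord_def zero_less_iff)

lemma less_osup_iff: "countable A \<Longrightarrow> b < osup A \<longleftrightarrow> (\<exists>a\<in>A. b < a)"
  using osup_le_iff[of A b] by (metis not_le)

lemma osup_lessThan_limit: "limit_ord a \<Longrightarrow> osup {..<a} = a"
  using osup_le_iff[OF countable_below] less_osup_iff[OF countable_below]
  by (metis antisym lessThan_iff less_imp_le limit_ord_osuc_less not_less osuc_greater)

lemma less_osup_image_iff: "b < osup (f ` {..<a :: omega1}) \<longleftrightarrow> (\<exists>c<a. b < f c)"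
  by (subst less_osup_iff) (auto intro: countable_image countable_below)

section \<open>Addition and left subtraction\<close>

lemma plus_zero [simp]: "a + 0 = (a :: omega1)"
  by (simp add: plus_omega1_def trec_0)

lemma plus_osuc: "a + osuc b = osuc (a + b)"
  by (simp add: plus_omega1_def trec_osuc)

lemma plus_limit: "limit_ord b \<Longrightarrow> a + b = osup ((+) a ` {..<b})"
  by (simp add: plus_omega1_def [abs_def] trec_limit)

lemma plus_less_mono: "b < c \<Longrightarrow> a + b < a + (c :: omega1)"
proof (induction c rule: omega1_induct)
  case (osuc c)
  then show ?case
    by (auto simp: plus_osuc less_osuc_iff le_less)
next
  case (limit c)
  then have "osuc b < c" "b < osuc b"
    by (auto intro: limit_ord_osuc_less osuc_greater)
  then show ?case
    using limit by (auto simp: plus_limit less_osup_image_iff)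
qed simp

lemma plus_less_iff [simp]: "a + b < a + c \<longleftrightarrow> b < (c :: omega1)"
  by (metis plus_less_mono less_asym less_linear)

lemma plus_le_iff [simp]: "a + b \<le> a + c \<longleftrightarrow> b \<le> (c :: omega1)"
  by (simp add: not_less[symmetric])

lemma zero_plus [simp]: "0 + b = (b :: omega1)"
proof (induction b rule: omega1_induct)
  case (limit b)
  then have "(+) 0 ` {..<b} = {..<b}"
    by force
  with limit show ?case
    by (simp add: plus_limit osup_lessThan_limit)
qed (auto simp: plus_osuc)

lemma le_plus1: "a \<le> a + (b :: omega1)"
  by (metis plus_le_iff plus_zero zero_le_omega1)

text \<open>A least counterexample \<open>a\<close> would have \<open>f a < a\<close>, hence
  \<open>f (f a) < f a\<close>, making \<open>f a\<close> a smaller one.\<close>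

lemma strict_mono_inflationary: "(\<And>b c :: omega1. b < c \<Longrightarrow> f b < f c) \<Longrightarrow> a \<le> f a"
  by (induction a rule: less_induct) (metis not_le)

lemma le_plus2: "b \<le> a + (b :: omega1)"
  by (rule strict_mono_inflationary) simp

text \<open>Left subtraction. The least \<open>c\<close> with \<open>b \<le> a + c\<close> cannot
  overshoot: \<open>a + c\<close> is the supremum or the immediate successor of sums still below
  \<open>b\<close>, and for \<open>c = 0\<close> the assumption \<open>a \<le> b\<close>
  applies.\<close>

lemma le_imp_plus:
  assumes "a \<le> (b :: omega1)"
  obtains c where "b = a + c"
proof -
  define c where "c = (LEAST c. b \<le> a + c)"
  have ge: "b \<le> a + c"
    unfolding c_def by (rule LeastI[of _ b]) (rule le_plus2)
  have least: "a + d < b" if "d < c" for d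
    using not_less_Least that unfolding c_def by (meson not_le)
  have "a + c \<le> b"
  proof (cases "c = 0 \<or> limit_ord c")
    case True
    moreover have "\<not> b < osup ((+) a ` {..<c})"
      using least less_asym by (auto simp: less_osup_image_iff)
    ultimately show ?thesis
      using assms by (auto simp: plus_limit not_less)
  next
    case False
    then obtain d where "c = osuc d"
      by (auto simp: limit_ord_def)
    then show ?thesis
      using least[of d] by (simp add: osuc_greater plus_osuc osuc_le_iff)
  qed
  with ge that show thesis
    by (meson antisym)
qed

section \<open>Finite ordinals, \<omega> and powers of \<omega>\<close>

lemma fin_ord_0 [simp]: "fin_ord 0 = 0"
  and fin_ord_Suc: "fin_ord (Suc n) = osuc (fin_ord n)"
  by (simp_all add: fin_ord_def)

lemma less_fin_ord: "b < fin_ord n \<Longrightarrow> \<exists>m<n. b = fin_ord m"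
proof (induction n)
  case (Suc n)
  then have "b < fin_ord n \<or> b = fin_ord n"
    by (simp add: fin_ord_Suc less_osuc_iff le_less)
  with Suc.IH show ?case
    using less_Suc_eq by blast
qed simp

lemma less_omega_iff: "b < \<omega> \<longleftrightarrow> (\<exists>n. b = fin_ord n)"
proof -
  have "b < \<omega> \<longleftrightarrow> (\<exists>n. b < fin_ord n)"
    by (simp add: omega_def less_osup_iff)
  then show ?thesis
    by (metis less_fin_ord fin_ord_Suc osuc_greater)
qed

lemma limit_ord_omega: "limit_ord \<omega>"
  unfolding limit_ord_def
  by (metis fin_ord_0 fin_ord_Suc less_omega_iff osuc_greater less_irrefl)

lemma times_zero [simp]: "a * 0 = (0 :: omega1)"
  by (simp add: times_omega1_def trec_0)

lemma times_fin_ord_Suc: "a * fin_ord (Suc n) = a * fin_ord n + a"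
  by (simp add: times_omega1_def trec_osuc fin_ord_Suc)

lemma less_times_omega_iff: "b < a * \<omega> \<longleftrightarrow> (\<exists>n. b < a * fin_ord n)"
proof -
  have "a * \<omega> = osup ((*) a ` {..<\<omega>})"
    by (simp add: times_omega1_def [abs_def] trec_limit limit_ord_omega)
  then show ?thesis
    by (auto simp: less_osup_image_iff less_omega_iff)
qed

lemma times_fin_ord_mono: "m \<le> n \<Longrightarrow> a * fin_ord m \<le> a * fin_ord n"
proof (induction n)
  case (Suc n)
  then show ?case
    using le_plus1[of "a * fin_ord n" a] by (auto simp: le_Suc_eq times_fin_ord_Suc)
qed simp

lemma oexp_zero [simp]: "oexp a 0 = 1"
  by (simp add: oexp_def trec_0)

lemma one_omega1_pos [simp]: "0 < (1 :: omega1)"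
  by (simp add: one_omega1_def osuc_greater)

lemma less_one_iff: "a < (1 :: omega1) \<longleftrightarrow> a = 0"
  using zero_le_omega1[of a] by (auto simp: one_omega1_def less_osuc_iff)

lemma one_le_iff: "1 \<le> a \<longleftrightarrow> 0 < (a :: omega1)"
  by (simp add: one_omega1_def osuc_le_iff)

lemma less_oexp_osuc_iff: "b < oexp \<omega> (osuc \<beta>) \<longleftrightarrow> (\<exists>n. b < oexp \<omega> \<beta> * fin_ord n)"
  by (simp add: oexp_def trec_osuc less_times_omega_iff)

lemma less_oexp_limit_iff: "limit_ord \<beta> \<Longrightarrow> b < oexp a \<beta> \<longleftrightarrow> (\<exists>\<gamma><\<beta>. b < oexp a \<gamma>)"
proof -
  assume "limit_ord \<beta>"
  then have "oexp a \<beta> = osup (oexp a ` {..<\<beta>})"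
    by (simp add: oexp_def [abs_def] trec_limit)
  then show ?thesis
    by (simp add: less_osup_image_iff)
qed

lemma oexp_pos: "0 < oexp \<omega> \<beta>"
proof (induction \<beta> rule: omega1_induct)
  case (osuc \<beta>)
  then have "0 < oexp \<omega> \<beta> * fin_ord (Suc 0)"
    by (simp add: times_fin_ord_Suc)
  then show ?case
    unfolding less_oexp_osuc_iff by blast
next
  case (limit \<beta>)
  then show ?case
    using limit_ord_pos by (auto simp: less_oexp_limit_iff)
qed simp

lemma oexp_times_fin_ord_less: "oexp \<omega> \<beta> * fin_ord n < oexp \<omega> (osuc \<beta>)"
proof -
  have "oexp \<omega> \<beta> * fin_ord n < oexp \<omega> \<beta> * fin_ord (Suc n)"
    using plus_less_mono[OF oexp_pos, of "oexp \<omega> \<beta> * fin_ord n" \<beta>] by (simp add: times_fin_ord_Suc)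
  then show ?thesis
    unfolding less_oexp_osuc_iff by blast
qed

lemma oexp_strict_mono: "\<beta> < \<gamma> \<Longrightarrow> oexp \<omega> \<beta> < oexp \<omega> \<gamma>"
proof (induction \<gamma> rule: omega1_induct)
  case (osuc \<gamma>)
  have "oexp \<omega> \<gamma> < oexp \<omega> (osuc \<gamma>)"
    using oexp_times_fin_ord_less[of \<gamma> "Suc 0"] by (simp add: times_fin_ord_Suc)
  with osuc show ?case
    by (auto simp: less_osuc_iff le_less)
next
  case (limit \<gamma>)
  then have "osuc \<beta> < \<gamma>" "\<beta> < osuc \<beta>"
    by (auto intro: limit_ord_osuc_less osuc_greater)
  with limit show ?case
    by (auto simp: less_oexp_limit_iff)
qed simp

lemma oexp_mono: "\<beta> \<le> \<gamma> \<Longrightarrow> oexp \<omega> \<beta> \<le> oexp \<omega> \<gamma>"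
  by (auto simp: le_less oexp_strict_mono)

lemma le_oexp: "\<beta> \<le> oexp \<omega> \<beta>"
  by (rule strict_mono_inflationary) (rule oexp_strict_mono)

text \<open>Division with remainder: the least multiple of \<open>oexp \<omega> \<beta>\<close>
  exceeding \<open>b\<close> is not the zeroth, and going back one step leaves a remainder below
  \<open>oexp \<omega> \<beta>\<close>.\<close>

lemma less_oexp_osucE:
  assumes "b < oexp \<omega> (osuc \<beta>)"
  obtains n r where "b = oexp \<omega> \<beta> * fin_ord n + r" "r < oexp \<omega> \<beta>"
proof -
  define m where "m = (LEAST n. b < oexp \<omega> \<beta> * fin_ord n)"
  have m: "b < oexp \<omega> \<beta> * fin_ord m"
    using assms unfolding m_def less_oexp_osuc_iff by (rule LeastI_ex)
  then obtain n where n: "m = Suc n"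
    by (cases m) auto
  then have "oexp \<omega> \<beta> * fin_ord n \<le> b"
    using not_less_Least[of n "\<lambda>n. b < oexp \<omega> \<beta> * fin_ord n"] m_def by (simp add: not_less)
  then obtain r where "b = oexp \<omega> \<beta> * fin_ord n + r"
    by (rule le_imp_plus)
  with m n that show thesis
    by (simp add: times_fin_ord_Suc)
qed


subsection \<open>Cantor normal forms\<close>

text \<open>The innermost value \<open>u\<close> is a parameter so that a normal form can be cut at
  any exponent and a common leading part cancelled.\<close>

definition cnf_terms :: "(omega1 \<Rightarrow>\<^sub>0 nat) \<Rightarrow> omega1 list \<Rightarrow> omega1 \<Rightarrow> omega1"
  where "cnf_terms c = foldr (\<lambda>\<beta> u. oexp \<omega> \<beta> * fin_ord (Poly_Mapping.lookup c \<beta>) + u)"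

lemma cnf_terms_Nil [simp]: "cnf_terms c [] u = u"
  and cnf_terms_Cons [simp]: "cnf_terms c (\<beta> # l) u =
    oexp \<omega> \<beta> * fin_ord (Poly_Mapping.lookup c \<beta>) + cnf_terms c l u"
  and cnf_terms_append [simp]: "cnf_terms c (l @ l') u = cnf_terms c l (cnf_terms c l' u)"
  by (simp_all add: cnf_terms_def)

lemma cnf_terms_cong: "(\<And>\<beta>. \<beta> \<in> set l \<Longrightarrow> Poly_Mapping.lookup c \<beta> = Poly_Mapping.lookup c' \<beta>)
    \<Longrightarrow> cnf_terms c l u = cnf_terms c' l u"
  by (induction l) auto

lemma cnf_terms_less_iff [simp]: "cnf_terms c l u < cnf_terms c l v \<longleftrightarrow> u < v"
  by (induction l) auto

lemma cnf_terms_filter: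
  "cnf_terms c (filter (\<lambda>\<beta>. Poly_Mapping.lookup c \<beta> \<noteq> 0) l) u = cnf_terms c l u"
  by (induction l) auto

text \<open>Zero coefficients contribute nothing, so two normal forms with different supports can be
  written over one common index set and compared term by term.\<close>

lemma cnf_ord_eq_cnf_terms:
  assumes "finite A" "Poly_Mapping.keys c \<subseteq> A"
  shows "cnf_ord c = cnf_terms c (rev (sorted_list_of_set A)) 0"
proof -
  have "sorted_list_of_set (Poly_Mapping.keys c)
      = filter (\<lambda>\<beta>. Poly_Mapping.lookup c \<beta> \<noteq> 0) (sorted_list_of_set A)"
  proof (rule sorted_distinct_set_unique)
    show "sorted (filter (\<lambda>\<beta>. Poly_Mapping.lookup c \<beta> \<noteq> 0) (sorted_list_of_set A))"
      by (rule sorted_wrt_filter) simp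
    show "set (sorted_list_of_set (Poly_Mapping.keys c))
        = set (filter (\<lambda>\<beta>. Poly_Mapping.lookup c \<beta> \<noteq> 0) (sorted_list_of_set A))"
      using assms by (auto simp: in_keys_iff)
  qed simp_all
  then have "cnf_ord c
      = cnf_terms c (filter (\<lambda>\<beta>. Poly_Mapping.lookup c \<beta> \<noteq> 0) (rev (sorted_list_of_set A))) 0"
    by (simp add: cnf_ord_def cnf_terms_def rev_filter)
  then show ?thesis
    by (simp only: cnf_terms_filter)
qed

lemma rev_sorted_list_of_set_split:
  fixes A :: "'a :: linorder set"
  assumes "finite A" "\<beta> \<in> A"
  shows "rev (sorted_list_of_set A) = rev (sorted_list_of_set (A \<inter> {\<beta><..})) @ \<beta> #
    rev (sorted_list_of_set (A \<inter> {..<\<beta>}))"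
proof -
  have "sorted_list_of_set A =
      sorted_list_of_set (A \<inter> {..<\<beta>}) @ \<beta> # sorted_list_of_set (A \<inter> {\<beta><..})"
    using assms by (intro sorted_distinct_set_unique)
      (auto simp: sorted_append less_imp_le not_less not_le intro: less_trans order_trans)
  then show ?thesis
    by simp
qed

text \<open>Exponents decrease along the list, so each tail is smaller than one further copy of the
  power preceding it. This makes the first differing coefficient decisive.\<close>

lemma cnf_terms_less_oexp:
  assumes "sorted_wrt (>) l" "\<And>\<gamma>. \<gamma> \<in> set l \<Longrightarrow> \<gamma> < \<beta>"
  shows "cnf_terms c l 0 < oexp \<omega> \<beta>"
  using assms
proof (induction l arbitrary: \<beta>)
  case (Cons \<gamma> l)
  let ?n = "Poly_Mapping.lookup c \<gamma>"
  have "cnf_terms c l 0 < oexp \<omega> \<gamma>"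
    using Cons by auto
  then have "cnf_terms c (\<gamma> # l) 0 < oexp \<omega> \<gamma> * fin_ord (Suc ?n)"
    by (simp add: times_fin_ord_Suc)
  also have "\<dots> < oexp \<omega> (osuc \<gamma>)"
    by (rule oexp_times_fin_ord_less)
  also have "\<dots> \<le> oexp \<omega> \<beta>"
    using Cons.prems by (intro oexp_mono) (simp add: osuc_le_iff)
  finally show ?case .
qed (simp add: oexp_pos)

lemma sorted_wrt_greater_rev_sorted_list_of_set:
  "sorted_wrt (>) (rev (sorted_list_of_set (A :: 'a :: linorder set)))"
  unfolding sorted_wrt_rev by (rule strict_sorted_list_of_set)

text \<open>The lexicographic order read from the largest exponent: \<beta> is the highest exponent
  at which the families disagree.\<close>

definition cnf_less :: "(omega1 \<Rightarrow>\<^sub>0 nat) \<Rightarrow> (omega1 \<Rightarrow>\<^sub>0 nat) \<Rightarrow> bool"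
  where "cnf_less c c' \<longleftrightarrow> (\<exists>\<beta>. Poly_Mapping.lookup c \<beta> < Poly_Mapping.lookup c' \<beta> \<and>
    (\<forall>\<gamma>>\<beta>. Poly_Mapping.lookup c \<gamma> = Poly_Mapping.lookup c' \<gamma>))"

lemma cnf_less_add: "cnf_less c c' \<Longrightarrow> cnf_less (c + d) (c' + d)"
  by (auto simp: cnf_less_def lookup_add)

lemma cnf_less_linear: "c = c' \<or> cnf_less c c' \<or> cnf_less c' c"
proof (cases "c = c'")
  case False
  let ?D = "{\<beta>. Poly_Mapping.lookup c \<beta> \<noteq> Poly_Mapping.lookup c' \<beta>}"
  have "?D \<subseteq> Poly_Mapping.keys c \<union> Poly_Mapping.keys c'"
    by (auto simp: in_keys_iff)
  then have fin: "finite ?D"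
    by (rule finite_subset) simp
  have "?D \<noteq> {}"
    using False by (auto simp: poly_mapping_eq_iff fun_eq_iff)
  with fin have Max: "Max ?D \<in> ?D"
    by (rule Max_in)
  obtain \<beta> where \<beta>: "\<beta> = Max ?D"
    by simp
  have "\<forall>\<gamma>>\<beta>. Poly_Mapping.lookup c \<gamma> = Poly_Mapping.lookup c' \<gamma>"
    using Max_ge[OF fin] unfolding \<beta> by (auto simp: not_le[symmetric])
  moreover have "Poly_Mapping.lookup c \<beta> < Poly_Mapping.lookup c' \<beta> \<or>
      Poly_Mapping.lookup c' \<beta> < Poly_Mapping.lookup c \<beta>"
    using Max unfolding \<beta> by (simp add: nat_neq_iff)
  ultimately show ?thesis
    unfolding cnf_less_def by auto
qed simp

text \<open>The terms above \<beta> agree and cancel as left summands. At \<beta> the larger family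
  has at least one more copy of \<open>oexp \<omega> \<beta>\<close>, which outweighs the entire
  remaining tail of the smaller one.\<close>

lemma cnf_ord_less:
  assumes "cnf_less c c'"
  shows "cnf_ord c < cnf_ord c'"
proof -
  obtain \<beta> where \<beta>: "Poly_Mapping.lookup c \<beta> < Poly_Mapping.lookup c' \<beta>"
      "\<And>\<gamma>. \<beta> < \<gamma> \<Longrightarrow> Poly_Mapping.lookup c \<gamma> = Poly_Mapping.lookup c' \<gamma>"
    using assms by (auto simp: cnf_less_def)
  define A where "A = insert \<beta> (Poly_Mapping.keys c \<union> Poly_Mapping.keys c')"
  define l where "l = rev (sorted_list_of_set (A \<inter> {\<beta><..}))"
  define l' where "l' = rev (sorted_list_of_set (A \<inter> {..<\<beta>}))"
  have A: "finite A" "Poly_Mapping.keys c \<subseteq> A" "Poly_Mapping.keys c' \<subseteq> A" "\<beta> \<in> A"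
    by (auto simp: A_def)
  have split: "cnf_ord d = cnf_terms d (l @ \<beta> # l') 0" if "Poly_Mapping.keys d \<subseteq> A" for d
    using cnf_ord_eq_cnf_terms[OF A(1) that]
    by (simp add: rev_sorted_list_of_set_split[OF A(1,4)] l_def l'_def)
  have "cnf_terms c l' 0 < oexp \<omega> \<beta>"
    using A(1) by (intro cnf_terms_less_oexp)
      (auto simp: l'_def sorted_wrt_greater_rev_sorted_list_of_set)
  then have "cnf_terms c (\<beta> # l') 0 < oexp \<omega> \<beta> * fin_ord (Suc (Poly_Mapping.lookup c \<beta>))"
    by (simp add: times_fin_ord_Suc)
  also have "\<dots> \<le> oexp \<omega> \<beta> * fin_ord (Poly_Mapping.lookup c' \<beta>)"
    using \<beta>(1) by (intro times_fin_ord_mono) simp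
  also have "\<dots> \<le> cnf_terms c' (\<beta> # l') 0"
    by (simp add: le_plus1)
  finally have "cnf_terms c l (cnf_terms c (\<beta> # l') 0) < cnf_terms c l (cnf_terms c' (\<beta> # l') 0)"
    by (simp only: cnf_terms_less_iff)
  also have "\<dots> = cnf_terms c' l (cnf_terms c' (\<beta> # l') 0)"
    using A(1) \<beta>(2) by (intro cnf_terms_cong) (auto simp: l_def)
  finally show ?thesis
    using split[OF A(2)] split[OF A(3)] by (simp only: cnf_terms_append)
qed

lemma cnf_ord_less_iff: "cnf_ord c < cnf_ord c' \<longleftrightarrow> cnf_less c c'"
  using cnf_less_linear[of c c'] by (auto dest: cnf_ord_less less_asym)

lemma cnf_ord_inject: "cnf_ord c = cnf_ord c' \<longleftrightarrow> c = c'"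
  using cnf_less_linear[of c c'] by (auto dest: cnf_ord_less)

text \<open>The bound on the exponents carries the induction: the remainder of the division uses
  exponents below \<beta> only, so the coefficient at \<beta> is free to be the quotient.\<close>

lemma cnf_ord_exists_below:
  "a < oexp \<omega> \<beta> \<Longrightarrow> \<exists>c. Poly_Mapping.keys c \<subseteq> {..<\<beta>} \<and> cnf_ord c = a"
proof (induction \<beta> arbitrary: a rule: omega1_induct)
  case zero
  then show ?case
    by (intro exI[of _ 0]) (auto simp: cnf_ord_def less_one_iff)
next
  case (osuc \<beta>)
  obtain n r where nr: "a = oexp \<omega> \<beta> * fin_ord n + r" "r < oexp \<omega> \<beta>"
    using less_oexp_osucE[OF osuc.prems] .
  obtain d where d: "Poly_Mapping.keys d \<subseteq> {..<\<beta>}" "cnf_ord d = r"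
    using osuc.IH[OF nr(2)] by blast
  define c where "c = d + Poly_Mapping.single \<beta> n"
  have c: "Poly_Mapping.lookup c \<gamma> = (if \<gamma> = \<beta> then n else Poly_Mapping.lookup d \<gamma>)" for \<gamma>
    using d(1) in_keys_iff[of \<beta> d] by (auto simp: c_def lookup_add lookup_single when_def)
  define A where "A = insert \<beta> (Poly_Mapping.keys d)"
  have A: "finite A" "Poly_Mapping.keys c \<subseteq> A" "Poly_Mapping.keys d \<subseteq> A" "\<beta> \<in> A"
    by (auto simp: A_def in_keys_iff c split: if_splits)
  define l where "l = rev (sorted_list_of_set (A \<inter> {..<\<beta>}))"
  have "A \<inter> {\<beta><..} = {}"
    using d(1) by (auto simp: A_def dest: less_asym)
  then have l: "rev (sorted_list_of_set A) = \<beta> # l"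
    using rev_sorted_list_of_set_split[OF A(1,4)] by (simp add: l_def)
  have "cnf_ord d = cnf_terms d (\<beta> # l) 0"
    using cnf_ord_eq_cnf_terms[OF A(1,3)] l by simp
  also have "\<dots> = cnf_terms d l 0"
    using d(1) in_keys_iff[of \<beta> d] by auto
  also have "\<dots> = cnf_terms c l 0"
    using A(1) by (intro cnf_terms_cong) (auto simp: c l_def)
  finally have "cnf_terms c l 0 = r"
    by (simp add: d(2))
  then have "cnf_ord c = a"
    using cnf_ord_eq_cnf_terms[OF A(1,2)] l by (simp add: nr(1) c)
  moreover have "Poly_Mapping.keys c \<subseteq> {..<osuc \<beta>}"
    using d(1) A(2) by (force simp: A_def less_osuc_iff)
  ultimately show ?case
    by blast
next
  case (limit \<beta>)
  then obtain \<gamma> where "\<gamma> < \<beta>" "a < oexp \<omega> \<gamma>"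
    by (auto simp: less_oexp_limit_iff)
  moreover from this limit.IH obtain c where "Poly_Mapping.keys c \<subseteq> {..<\<gamma>}" "cnf_ord c = a"
    by blast
  ultimately show ?case
    by (intro exI[of _ c]) (auto intro: less_trans)
qed

lemma cnf_ord_cnf [simp]: "cnf_ord (cnf a) = a"
proof -
  have "a < oexp \<omega> (osuc a)"
    using le_oexp[of "osuc a"] osuc_greater[of a] by (rule order_less_le_trans[rotated])
  then obtain c where c: "cnf_ord c = a"
    using cnf_ord_exists_below by blast
  then show ?thesis
    unfolding cnf_def by (rule theI) (use c in \<open>auto simp: cnf_ord_inject\<close>)
qed

text \<open>Adding one family of coefficients on both sides does not disturb the lexicographic
  comparison.\<close>

lemma hessenberg_sum_less1: "a < a' \<Longrightarrow> hessenberg_sum a b < hessenberg_sum a' b"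
  using cnf_less_add[of "cnf a" "cnf a'" "cnf b"] cnf_ord_less_iff[of "cnf a" "cnf a'"]
  by (simp add: hessenberg_sum_def cnf_ord_less)

lemma hessenberg_sum_commute: "hessenberg_sum a b = hessenberg_sum b a"
  by (simp add: hessenberg_sum_def add.commute)

lemma hessenberg_sum_less2: "b < b' \<Longrightarrow> hessenberg_sum a b < hessenberg_sum a b'"
  using hessenberg_sum_less1[of b b' a] by (simp add: hessenberg_sum_commute)

lemma hessenberg_sum_mono:
  assumes "a \<le> a'" "b \<le> b'"
  shows "hessenberg_sum a b \<le> hessenberg_sum a' b'"
proof (rule order_trans)
  show "hessenberg_sum a b \<le> hessenberg_sum a' b"
    using assms(1) hessenberg_sum_less1[of a a' b] by (auto simp: le_less)
  show "hessenberg_sum a' b \<le> hessenberg_sum a' b'"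
    using assms(2) hessenberg_sum_less2[of b b' a'] by (auto simp: le_less)
qed

lemma hessenberg_sum_strict_mono:
  assumes "a \<le> a'" "b \<le> b'" "a < a' \<or> b < b'"
  shows "hessenberg_sum a b < hessenberg_sum a' b'"
  using assms(3)
proof
  assume "a < a'"
  then show ?thesis
    using hessenberg_sum_less1 hessenberg_sum_mono[OF order_refl assms(2)]
    by (meson order_less_le_trans)
next
  assume "b < b'"
  then show ?thesis
    using hessenberg_sum_less2 hessenberg_sum_mono[OF assms(1) order_refl]
    by (meson order_le_less_trans)
qed


subsection \<open>A rank on the countable ordinals\<close>

text \<open>An upper bound for the Cantor--Bendixson rank of the point \<open>s\<close>; only \<open>s > 0\<close> is meaningful.\<close>

function ord_rank :: "omega1 \<Rightarrow> omega1" where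
  "ord_rank s = (LEAST \<gamma>. \<exists>t<s. \<forall>u\<in>{t<..<s}. ord_rank u < \<gamma>)"
  by auto
termination
  by (relation "{(x, y). x < y}") (auto intro: wf)

declare ord_rank.simps [simp del]

lemma ord_rank_le: "t < s \<Longrightarrow> (\<And>u. t < u \<Longrightarrow> u < s \<Longrightarrow> ord_rank u < \<gamma>) \<Longrightarrow> ord_rank s \<le> \<gamma>"
  by (subst ord_rank.simps) (rule Least_le, auto)

text \<open>The minimum defining the rank exists: only countably many points lie below
  \<open>s\<close>, so their ranks have a common strict bound, and \<open>t = 0\<close> is a
  witness.\<close>

lemma ord_rank_lessE:
  assumes "0 < s"
  obtains t where "t < s" "\<And>u. t < u \<Longrightarrow> u < s \<Longrightarrow> ord_rank u < ord_rank s"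
proof -
  obtain \<gamma> where "\<forall>a\<in>ord_rank ` {..<s}. a < \<gamma>"
    using countable_strictly_bounded[OF countable_image[OF countable_below]] by blast
  with assms have "\<exists>t<s. \<forall>u\<in>{t<..<s}. ord_rank u < \<gamma>"
    by auto
  then have "\<exists>t<s. \<forall>u\<in>{t<..<s}. ord_rank u < (LEAST \<gamma>. \<exists>t<s. \<forall>u\<in>{t<..<s}. ord_rank u < \<gamma>)"
    by (rule LeastI)
  then show thesis
    using that unfolding ord_rank.simps[of s, symmetric] by auto
qed

text \<open>The interval from \<open>a + t\<close> to \<open>a + v\<close> is the left translate by
  \<open>a\<close> of the one from \<open>t\<close> to \<open>v\<close>, so bounds on the ranks just
  below \<open>v\<close> carry over inductively.\<close>

lemma ord_rank_plus_le: "0 < v \<Longrightarrow> ord_rank (a + v) \<le> ord_rank v"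
proof (induction v rule: less_induct)
  case (less v)
  obtain t where t: "t < v" "\<And>u. t < u \<Longrightarrow> u < v \<Longrightarrow> ord_rank u < ord_rank v"
    using ord_rank_lessE[OF less.prems] by blast
  show ?case
  proof (rule ord_rank_le)
    show "a + t < a + v"
      using t(1) by simp
    fix u
    assume u: "a + t < u" "u < a + v"
    then have "a \<le> u"
      using le_plus1[of a t] by simp
    then obtain w where w: "u = a + w"
      by (rule le_imp_plus)
    with u t have "t < w" "w < v"
      by auto
    moreover have "0 < w"
      using zero_le_omega1 \<open>t < w\<close> by (rule le_less_trans)
    ultimately show "ord_rank u < ord_rank v"
      using less.IH[of w] t(2)[of w] w by simp
  qed
qed

text \<open>In the successor step every point is a translate \<open>a + v\<close> with
  \<open>0 < v\<close> and \<open>v \<le> oexp \<omega> \<beta>\<close>. Such \<open>v\<close> have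
  rank at most \<beta>; for \<open>oexp \<omega> \<beta>\<close> itself this holds because all
  positive ordinals below it have rank less than \<beta>.\<close>

lemma ord_rank_less_of_less_oexp: "0 < u \<Longrightarrow> u < oexp \<omega> \<beta> \<Longrightarrow> ord_rank u < \<beta>"
proof (induction \<beta> arbitrary: u rule: omega1_induct)
  case zero
  then show ?case
    by (simp add: less_one_iff)
next
  case (osuc \<beta>)
  have le: "ord_rank v \<le> \<beta>" if "0 < v" "v \<le> oexp \<omega> \<beta>" for v
  proof (cases "v = oexp \<omega> \<beta>")
    case True
    then show ?thesis
      using osuc.IH oexp_pos by (auto intro: ord_rank_le[of 0])
  next
    case False
    with that osuc.IH[of v] show ?thesis
      by (simp add: order.strict_iff_order)
  qed
  have "\<exists>a v. u = a + v \<and> 0 < v \<and> v \<le> oexp \<omega> \<beta>"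
  proof -
    obtain n r where nr: "u = oexp \<omega> \<beta> * fin_ord n + r" "r < oexp \<omega> \<beta>"
      using less_oexp_osucE[OF osuc.prems(2)] .
    show ?thesis
    proof (cases "r = 0")
      case True
      \<comment> \<open>With remainder zero, the last full copy of
        \<open>oexp \<omega> \<beta>\<close> has to play the part of \<open>v\<close>; there is one
        because \<open>0 < u\<close>.\<close>
      with nr osuc.prems obtain m where "n = Suc m"
        by (cases n) auto
      with nr True have "u = oexp \<omega> \<beta> * fin_ord m + oexp \<omega> \<beta>"
        by (simp add: times_fin_ord_Suc)
      then show ?thesis
        using oexp_pos by blast
    next
      case False
      with nr show ?thesis
        by (metis less_imp_le zero_less_iff)
    qed
  qed
  then obtain a v where "u = a + v" "0 < v" "v \<le> oexp \<omega> \<beta>"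
    by blast
  then show ?case
    using le[of v] ord_rank_plus_le[of v a] by (auto simp: less_osuc_iff intro: order_trans)
next
  case (limit \<beta>)
  then obtain \<gamma> where "\<gamma> < \<beta>" "u < oexp \<omega> \<gamma>"
    by (auto simp: less_oexp_limit_iff)
  with limit show ?case
    using less_trans by blast
qed


subsection \<open>Cantor--Bendixson derivatives\<close>

lemma CB_derivative_osuc:
  "CB_derivative X (osuc a) = non_isolated (subtopology X (CB_derivative X a))"
  by (simp add: CB_derivative_def trec_osuc)

lemma CB_derivative_antimono: "a \<le> b \<Longrightarrow> CB_derivative X b \<subseteq> CB_derivative X a"
proof (induction b rule: omega1_induct)
  case zero
  then show ?case
    using zero_le_omega1[of a] by simp
next
  case (osuc b)
  show ?case
  proof (cases "a = osuc b")
    case False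
    with osuc.prems have "a < osuc b"
      by simp
    then have "a \<le> b"
      by (simp add: less_osuc_iff)
    then show ?thesis
      using osuc.IH by (auto simp: CB_derivative_osuc non_isolated_def)
  qed simp
next
  case (limit b)
  then show ?case
    by (cases "a = b") (auto simp: CB_derivative_def trec_limit)
qed

lemma CB_derivative_subset_topspace: "CB_derivative X a \<subseteq> topspace X"
  using CB_derivative_antimono[OF zero_le_omega1, of X a] by (simp add: CB_derivative_def trec_0)

lemma CB_derivative_accumulates:
  assumes "a < b" "x \<in> CB_derivative X b" "openin X W" "x \<in> W"
  obtains y where "y \<in> W" "y \<in> CB_derivative X a" "y \<noteq> x"
proof -
  have "x \<in> non_isolated (subtopology X (CB_derivative X a))"
    using assms(1,2) CB_derivative_antimono[of "osuc a" b X]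
    by (auto simp: osuc_le_iff CB_derivative_osuc)
  then have x: "x \<in> CB_derivative X a" "\<not> openin (subtopology X (CB_derivative X a)) {x}"
    by (auto simp: non_isolated_def)
  have "openin (subtopology X (CB_derivative X a)) (W \<inter> CB_derivative X a)"
    using assms(3) by (auto simp: openin_subtopology)
  with x(2) have "W \<inter> CB_derivative X a \<noteq> {x}"
    by auto
  with x(1) assms(4) that show thesis
    by blast
qed

text \<open>Each choice splits the current neighbourhood of \<open>x\<close> by the Hausdorff
  property: \<open>V\<close> surrounds a nearby point of the prescribed derivative, \<open>W\<close>
  is the room around \<open>x\<close> reserved for all later choices. The ordinals
  \<open>a n\<close> come in any order, so each piece can be given the rank that its target
  requires.\<close>

lemma CB_derivative_disjoint_neighbourhoods:
  fixes a :: "nat \<Rightarrow> omega1"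
  assumes "Hausdorff_space X" "\<And>n. a n < b" "x \<in> CB_derivative X b" "openin X U" "x \<in> U"
  obtains V where "\<And>n. openin X (V n)" "\<And>n. V n \<subseteq> U" "\<And>n. x \<notin> V n"
    "\<And>n. V n \<inter> CB_derivative X (a n) \<noteq> {}" "disjoint_family V"
proof -
  define P where "P n = (\<lambda>(V, W). openin X V \<and> openin X W \<and> x \<in> W \<and> V \<subseteq> U \<and> W \<subseteq> U \<and>
    V \<inter> W = {} \<and> V \<inter> CB_derivative X (a n) \<noteq> {})" for n
  have step: "\<exists>VW. P n VW \<and> fst VW \<subseteq> W \<and> snd VW \<subseteq> W" if W: "openin X W" "x \<in> W" "W \<subseteq> U" for n W
  proof -
    obtain y where y: "y \<in> W" "y \<in> CB_derivative X (a n)" "y \<noteq> x"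
      using CB_derivative_accumulates[OF assms(2,3) W(1,2)] by blast
    moreover have "x \<in> topspace X" "y \<in> topspace X"
      using y(1) W openin_subset by blast+
    ultimately obtain V' W' where "openin X V'" "openin X W'" "y \<in> V'" "x \<in> W'" "disjnt V' W'"
      using assms(1) unfolding Hausdorff_space_def by metis
    then have "P n (V' \<inter> W, W' \<inter> W)"
      using y W by (auto simp: P_def disjnt_def)
    then show ?thesis
      by fastforce
  qed
  have "\<exists>f. \<forall>n. P n (f n) \<and> fst (f (Suc n)) \<subseteq> snd (f n) \<and> snd (f (Suc n)) \<subseteq> snd (f n)"
  proof (rule dependent_nat_choice)
    show "\<exists>VW. P 0 VW"
      using step[OF assms(4,5)] by blast
    show "\<exists>VW'. P (Suc n) VW' \<and> fst VW' \<subseteq> snd VW \<and> snd VW' \<subseteq> snd VW" if "P n VW" for VW n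
      using that step[of "snd VW" "Suc n"] by (auto simp: P_def)
  qed
  then obtain f where f: "\<And>n. P n (f n)" "\<And>n. fst (f (Suc n)) \<subseteq> snd (f n)"
    "\<And>n. snd (f (Suc n)) \<subseteq> snd (f n)"
    by blast
  have "fst (f n) \<subseteq> snd (f m)" if "m < n" for m n
  proof -
    obtain k where k: "n = Suc k" "m \<le> k"
      using \<open>m < n\<close> by (cases n) auto
    have "snd (f k) \<subseteq> snd (f m)"
      using lift_Suc_antimono_le[of "\<lambda>n. snd (f n)", OF f(3) k(2)] .
    then show ?thesis
      using f(2)[of k] k(1) by blast
  qed
  moreover have "fst (f m) \<inter> snd (f m) = {}" for m
    using f(1)[of m] by (auto simp: P_def)
  ultimately have "fst (f m) \<inter> fst (f n) = {}" if "m < n" for m n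
    using that by blast
  then have "disjoint_family (\<lambda>n. fst (f n))"
    unfolding disjoint_family_on_def by (metis Int_commute linorder_neq_iff)
  then show thesis
    using that[of "\<lambda>n. fst (f n)"] f(1) by (auto simp: P_def case_prod_beta)
qed


subsection \<open>Mapping closed subsets onto scattered spaces\<close>

text \<open>Disjointed basic sets are clopen, hence compact, and each is a finite union of members
  of \<open>\<G>\<close>. The blocks converge to \<open>p\<close> because finitely many of the
  disjoint sets cover the compact set \<open>N - W\<close>, and all the others must lie in
  \<open>W\<close>. Blocks within one of these sets may overlap, which does no harm to a
  surjection.\<close>

lemma clopen_cover_punctured:
  fixes X :: "'a topology"
  assumes "compact_space X" "t1_space X" "countable (topspace X)"
    and base: "\<And>q W. openin X W \<Longrightarrow> q \<in> W \<Longrightarrow> W \<subseteq> N - {p} \<Longrightarrow>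
      \<exists>G\<in>\<G>. openin X G \<and> closedin X G \<and> q \<in> G \<and> G \<subseteq> W"
    and N: "openin X N" "closedin X N" "p \<in> N"
  obtains B where "\<And>n::nat. B n = {} \<or> B n \<in> \<G>" "(\<Union>n. B n) = N - {p}"
    "\<And>W. openin X W \<Longrightarrow> p \<in> W \<Longrightarrow> finite {n. \<not> B n \<subseteq> W}"
proof (cases "N - {p} = {}")
  case True
  then show thesis
    using that[of "\<lambda>n. {}"] by simp
next
  case False
  let ?M = "N - {p}"
  have "p \<in> topspace X"
    using N openin_subset by blast
  then have "closedin X {p}"
    using assms(2) by (simp add: t1_space_closedin_singleton)
  then have M: "openin X ?M"
    using N by (simp add: openin_diff)
  have "countable ?M"
    using openin_subset[OF M] assms(3) countable_subset by blast
  then obtain e :: "nat \<Rightarrow> 'a" where e: "range e = ?M"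
    using range_from_nat_into[OF False] by blast
  have "\<exists>G\<in>\<G>. openin X G \<and> closedin X G \<and> e n \<in> G \<and> G \<subseteq> ?M" for n :: nat
    using e by (intro base[OF M]) auto
  then obtain G where G: "\<And>n. openin X (G n)" "\<And>n. closedin X (G n)" "\<And>n. e n \<in> G n"
    "\<And>n. G n \<subseteq> ?M"
    by metis
  define V where "V = disjointed G"
  have disj: "disjoint_family V"
    unfolding V_def by (rule disjoint_family_disjointed)
  have "(\<Union>n. G n) = ?M"
    using G(3,4) unfolding e[symmetric] by blast
  then have UN_V: "(\<Union>n. V n) = ?M"
    by (simp add: V_def UN_disjointed_eq)
  have V: "openin X (V n)" "closedin X (V n)" for n
    using G(1,2) unfolding V_def disjointed_def
    by (auto intro!: openin_diff closedin_diff closedin_Union openin_Union)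
  have "\<exists>F. finite F \<and> F \<subseteq> \<G> \<and> \<Union>F = V n" for n
  proof -
    define \<C> where "\<C> = {G \<in> \<G>. openin X G \<and> G \<subseteq> V n}"
    have "compactin X (V n)"
      using assms(1) V(2) by (rule closedin_compact_space)
    moreover have "V n \<subseteq> \<Union>\<C>"
    proof
      fix q
      assume "q \<in> V n"
      moreover have "V n \<subseteq> ?M"
        using UN_V by blast
      ultimately obtain G where "G \<in> \<G>" "openin X G" "q \<in> G" "G \<subseteq> V n"
        using base[OF V(1)] by blast
      then show "q \<in> \<Union>\<C>"
        unfolding \<C>_def by blast
    qed
    moreover have "openin X T" if "T \<in> \<C>" for T
      using that by (simp add: \<C>_def)
    ultimately obtain F where "finite F" "F \<subseteq> \<C>" "V n \<subseteq> \<Union>F"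
      by (meson compactinD)
    then show ?thesis
      unfolding \<C>_def by (intro exI[of _ F]) auto
  qed
  then obtain F where F: "\<And>n. finite (F n)" "\<And>n. F n \<subseteq> \<G>" "\<And>n. \<Union>(F n) = V n"
    by metis
  define \<B> where "\<B> = (\<Union>n. F n)"
  have \<B>: "countable \<B>"
    unfolding \<B>_def using F(1) by (auto intro: countable_finite)
  have fin: "finite {b \<in> \<B>. \<not> b \<subseteq> W}" if "openin X W" "p \<in> W" for W
  proof -
    have "compactin X (N - W)"
      using assms(1) N that by (auto intro: closedin_compact_space closedin_diff)
    moreover have "N - W \<subseteq> \<Union>(range V)"
      using that UN_V by auto
    ultimately obtain \<F> where \<F>: "finite \<F>" "\<F> \<subseteq> range V" "N - W \<subseteq> \<Union>\<F>"
      using V(1) compactinD[of X "N - W" "range V"] by blast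
    then obtain S where S: "finite S" "\<F> = V ` S"
      by (meson finite_subset_image)
    have "V n \<subseteq> W" if "n \<notin> S" for n
    proof
      fix q
      assume "q \<in> V n"
      have "q \<notin> V m" if "m \<in> S" for m
        using disjoint_family_onD[OF disj, of n m] \<open>n \<notin> S\<close> that \<open>q \<in> V n\<close> by auto
      then have "q \<notin> \<Union>\<F>"
        unfolding S(2) by blast
      moreover have "q \<in> N"
        using \<open>q \<in> V n\<close> UN_V by blast
      ultimately show "q \<in> W"
        using \<F>(3) by blast
    qed
    moreover have "b \<subseteq> V n" if "b \<in> F n" for b n
      using that F(3)[of n] by blast
    ultimately have "{b \<in> \<B>. \<not> b \<subseteq> W} \<subseteq> (\<Union>n\<in>S. F n)"
      unfolding \<B>_def by fast
    moreover have "finite (\<Union>n\<in>S. F n)"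
      using S(1) F(1) by simp
    ultimately show ?thesis
      by (rule finite_subset)
  qed
  \<comment> \<open>Indices that encode no block receive the empty set, which also handles a finite
    family. Each block has a single index under \<open>to_nat_on\<close>, so finitely many bad
    blocks mean finitely many bad indices.\<close>
  define B where "B n = (if n \<in> to_nat_on \<B> ` \<B> then from_nat_into \<B> n else {})" for n
  have B: "B (to_nat_on \<B> b) = b" if "b \<in> \<B>" for b
    using that \<B> by (simp add: B_def)
  have B': "B n = {} \<or> (\<exists>b\<in>\<B>. n = to_nat_on \<B> b \<and> B n = b)" for n
    using B by (cases "n \<in> to_nat_on \<B> ` \<B>") (auto simp: B_def)
  show thesis
  proof (rule that)
    show "B n = {} \<or> B n \<in> \<G>" for n
    proof -
      have "\<B> \<subseteq> \<G>"
        unfolding \<B>_def using F(2) by (rule UN_least)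
      then show ?thesis
        using B'[of n] by auto
    qed
    have "(\<Union>n. B n) = \<Union>\<B>"
    proof (intro equalityI subsetI)
      show "q \<in> \<Union>\<B>" if "q \<in> (\<Union>n. B n)" for q
        using that B' by fastforce
      show "q \<in> (\<Union>n. B n)" if "q \<in> \<Union>\<B>" for q
        using that B by fastforce
    qed
    also have "\<dots> = (\<Union>n. V n)"
      unfolding \<B>_def F(3)[symmetric] by blast
    finally show "(\<Union>n. B n) = ?M"
      by (simp only: UN_V)
    fix W
    assume "openin X W" "p \<in> W"
    have "{n. \<not> B n \<subseteq> W} \<subseteq> to_nat_on \<B> ` {b \<in> \<B>. \<not> b \<subseteq> W}"
      using B' by fastforce
    then show "finite {n. \<not> B n \<subseteq> W}"
      using fin[OF \<open>openin X W\<close> \<open>p \<in> W\<close>] by (rule finite_surj[rotated])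
  qed
qed

text \<open>Pieces of \<open>K\<close> lying in disjoint open sets are glued; whatever their closure adds is sent
  to \<open>p\<close>, which is continuous because the images shrink to \<open>p\<close>.\<close>

lemma glue_converging_maps:
  assumes "closedin K D" and x: "x \<in> D" "\<And>n. x \<notin> V n" and p: "p \<in> topspace X"
    and V: "\<And>n. openin K (V n)" "\<And>n. V n \<subseteq> D" "disjoint_family V"
    and C: "\<And>n. closedin K (C n)" "\<And>n. C n \<subseteq> V n"
    and \<phi>: "\<And>n. continuous_map (subtopology K (C n)) X (\<phi> n)"
    and shrink: "\<And>W. openin X W \<Longrightarrow> p \<in> W \<Longrightarrow> finite {n::nat. \<not> \<phi> n ` C n \<subseteq> W}"
  obtains C' \<phi>' where "closedin K C'" "C' \<subseteq> D" "continuous_map (subtopology K C') X \<phi>'"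
    "\<phi>' ` C' = insert p (\<Union>n. \<phi> n ` C n)"
proof -
  \<comment> \<open>Each removed set \<open>V n - C n\<close> is open, so \<open>C'\<close> is
    closed, and since \<open>V n\<close> meets it in \<open>C n\<close>, every \<open>C n\<close> is
    relatively clopen in \<open>C'\<close>.\<close>
  define C' where "C' = D - (\<Union>n. V n - C n)"
  define \<phi>' where "\<phi>' y = (if \<exists>n. y \<in> C n then \<phi> (SOME n. y \<in> C n) y else p)" for y
  have closed: "closedin K C'"
    unfolding C'_def using assms(1) V(1) C(1) by (intro closedin_diff) (auto intro: openin_diff)
  have disj: "m = n" if "y \<in> V m" "y \<in> V n" for y m n
    using V(3) that unfolding disjoint_family_on_def by blast
  have C'_V: "C' \<inter> V n = C n" for n
    using V(2) C(2) disj unfolding C'_def by blast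
  have \<phi>'_C: "\<phi>' y = \<phi> n y" if "y \<in> C n" for y n
  proof -
    have "(SOME n. y \<in> C n) = n"
      using that C(2) disj by (intro some_equality) blast+
    with that show ?thesis
      by (auto simp: \<phi>'_def)
  qed
  have \<phi>'_p: "\<phi>' y = p" if "\<And>n. y \<notin> C n" for y
    using that by (simp add: \<phi>'_def)
  \<comment> \<open>The point \<open>x\<close> lies outside every \<open>V n\<close>, so it survives
    in \<open>C'\<close> and makes \<open>p\<close> a value of the map.\<close>
  have "x \<in> C'" "\<phi>' x = p"
    using x C(2) \<phi>'_p unfolding C'_def by blast+
  then have image: "\<phi>' ` C' = insert p (\<Union>n. \<phi> n ` C n)"
    using C'_V \<phi>'_C \<phi>'_p by (auto simp: image_iff) (metis IntE)+
  have C_top: "topspace (subtopology K (C n)) = C n" for n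
    using closedin_subset[OF C(1)[of n]] by auto
  have C'_top: "topspace (subtopology K C') = C'"
    using closedin_subset[OF closed] by auto
  have "openin (subtopology K C') {y \<in> C'. \<phi>' y \<in> W}" if W: "openin X W" for W
  proof (cases "p \<in> W")
    case False
    have "openin (subtopology K C') {y \<in> C n. \<phi> n y \<in> W}" for n
    proof -
      have "openin (subtopology K (C n)) {y \<in> C n. \<phi> n y \<in> W}"
        using openin_continuous_map_preimage[OF \<phi>[of n] W] by (simp only: C_top)
      then obtain T where "openin K T" "{y \<in> C n. \<phi> n y \<in> W} = T \<inter> C n"
        by (auto simp: openin_subtopology)
      then have "{y \<in> C n. \<phi> n y \<in> W} = (T \<inter> V n) \<inter> C'" "openin K (T \<inter> V n)"
        using C'_V[of n] V(1) by auto
      then show ?thesis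
        by (auto simp: openin_subtopology)
    qed
    moreover have "{y \<in> C'. \<phi>' y \<in> W} = (\<Union>n. {y \<in> C n. \<phi> n y \<in> W})"
      using False C'_V \<phi>'_C \<phi>'_p by auto metis+
    ultimately show ?thesis
      by auto
  next
    case True
    \<comment> \<open>Only points of the finitely many pieces not mapped into \<open>W\<close> miss
      the preimage, so its complement is a finite union of closed sets.\<close>
    have "closedin (subtopology K C') {y \<in> C n. \<phi> n y \<in> topspace X - W}" for n
    proof -
      have "closedin (subtopology K (C n)) {y \<in> C n. \<phi> n y \<in> topspace X - W}"
        using closedin_continuous_map_preimage[OF \<phi>[of n] closedin_diff[OF closedin_topspace W]]
        by (simp only: C_top)
      then have "closedin K {y \<in> C n. \<phi> n y \<in> topspace X - W}"
        using C(1) by (rule closedin_trans_full)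
      moreover have "{y \<in> C n. \<phi> n y \<in> topspace X - W} \<subseteq> C'"
        using C'_V[of n] by auto
      ultimately show ?thesis
        by (rule closedin_subset_topspace)
    qed
    then have "closedin (subtopology K C')
        (\<Union>n\<in>{n. \<not> \<phi> n ` C n \<subseteq> W}. {y \<in> C n. \<phi> n y \<in> topspace X - W})"
      using shrink[OF W True] by (intro closedin_Union) auto
    moreover have "{y \<in> C'. \<phi>' y \<in> W}
        = C' - (\<Union>n\<in>{n. \<not> \<phi> n ` C n \<subseteq> W}. {y \<in> C n. \<phi> n y \<in> topspace X - W})" (is "?L = C' - ?R")
    proof -
      have "\<phi> n y \<in> topspace X" if "y \<in> C n" for n y
        using \<phi>[of n] that C_top unfolding continuous_map_def by blast
      then have "\<phi>' y \<notin> W \<longleftrightarrow> y \<in> ?R" for y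
        using True \<phi>'_C[of y] \<phi>'_p[of y] by (cases "\<exists>n. y \<in> C n") fastforce+
      then show ?thesis
        by blast
    qed
    ultimately show ?thesis
      using openin_topspace[of "subtopology K C'"] by (simp only: C'_top openin_diff)
  qed
  moreover have "\<phi>' ` C' \<subseteq> topspace X"
    using p \<phi> C_top unfolding image continuous_map_def by auto
  ultimately have "continuous_map (subtopology K C') X \<phi>'"
    unfolding continuous_map C'_top by blast
  moreover have "C' \<subseteq> D"
    by (auto simp: C'_def)
  ultimately show thesis
    using that closed image by blast
qed

text \<open>The open set \<open>U\<close> belongs to the claim so that the parts of \<open>K\<close>
  mapped onto different blocks can be kept in disjoint open sets. The induction on the rank of
  \<open>p\<close> therefore treats all \<open>N\<close>, \<open>U\<close> and \<open>x\<close> at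
  once.\<close>

proposition CB_derivative_maps_onto_scattered:
  fixes K :: "'k topology" and X :: "'a topology" and r :: "'a \<Rightarrow> omega1"
  assumes K: "compact_space K" "Hausdorff_space K"
    and X: "compact_space X" "t1_space X" "countable (topspace X)"
    and base: "\<And>q W. openin X W \<Longrightarrow> q \<in> W \<Longrightarrow>
      \<exists>G. openin X G \<and> closedin X G \<and> q \<in> G \<and> G \<subseteq> W \<and> (\<forall>u\<in>G - {q}. r u < r q)"
    and "openin X N" "closedin X N" "p \<in> N" "\<And>q. q \<in> N - {p} \<Longrightarrow> r q < r p"
    and "openin K U" "x \<in> U" "x \<in> CB_derivative K (r p)"
  shows "\<exists>C \<phi>. closedin K C \<and> C \<subseteq> U \<and> continuous_map (subtopology K C) X \<phi> \<and> \<phi> ` C = N"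
  using assms(7-)
proof (induction "r p" arbitrary: p N U x rule: less_induct)
  case less
  have p: "p \<in> topspace X" and x: "x \<in> topspace K"
    using less.prems openin_subset by blast+
  show ?case
  proof (cases "r p = 0")
    case True
    with less.prems have "N = {p}"
      by auto
    moreover have "closedin K {x}"
      using K(2) x by (simp add: closedin_Hausdorff_singleton)
    moreover have "continuous_map (subtopology K {x}) X (\<lambda>y. p)"
      using p by simp
    ultimately show ?thesis
      using less.prems by (intro exI[of _ "{x}"] exI[of _ "\<lambda>y. p"]) auto
  next
    case False
    define \<G> where "\<G> = {G. openin X G \<and> closedin X G \<and>
      (\<exists>q\<in>G. r q < r p \<and> (\<forall>u\<in>G - {q}. r u < r q))}"
    have \<G>: "\<exists>G\<in>\<G>. openin X G \<and> closedin X G \<and> q \<in> G \<and> G \<subseteq> W"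
      if W: "openin X W" "q \<in> W" "W \<subseteq> N - {p}" for q W
    proof -
      obtain G where "openin X G" "closedin X G" "q \<in> G" "G \<subseteq> W" "\<forall>u\<in>G - {q}. r u < r q"
        using base[OF W(1,2)] by blast
      moreover have "r q < r p"
        using W less.prems(4) by blast
      ultimately show ?thesis
        unfolding \<G>_def by blast
    qed
    obtain B where B: "\<And>n::nat. B n = {} \<or> B n \<in> \<G>" "(\<Union>n. B n) = N - {p}"
      "\<And>W. openin X W \<Longrightarrow> p \<in> W \<Longrightarrow> finite {n. \<not> B n \<subseteq> W}"
      using clopen_cover_punctured[OF X \<G> less.prems(1-3)] by blast
    \<comment> \<open>Each nonempty block prescribes the rank of its centre; an empty one takes
      \<open>0\<close>, which is below \<open>r p\<close> in this case.\<close>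
    have "\<exists>a<r p. B n = {} \<or> (\<exists>q\<in>B n. a = r q \<and> (\<forall>u\<in>B n - {q}. r u < r q))" for n
    proof (cases "B n = {}")
      case True
      with \<open>r p \<noteq> 0\<close> show ?thesis
        by (intro exI[of _ 0]) (simp add: zero_less_iff)
    next
      case False
      then have "B n \<in> \<G>"
        using B(1) by blast
      then show ?thesis
        unfolding \<G>_def by blast
    qed
    then obtain a where a: "\<And>n. a n < r p"
      "\<And>n. B n = {} \<or> (\<exists>q\<in>B n. a n = r q \<and> (\<forall>u\<in>B n - {q}. r u < r q))"
      by metis
    \<comment> \<open>Gluing adds limit points of the pieces. To keep these in \<open>U\<close> as
      well, regularity puts a closed \<open>D\<close> between \<open>U\<close> and the open set
      \<open>U'\<close> containing the pieces.\<close>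
    have "neighbourhood_base_of (closedin K) K"
      using K by (simp add: neighbourhood_base_of_closedin compact_Hausdorff_imp_regular_space)
    then have "\<exists>U' D. openin K U' \<and> closedin K D \<and> x \<in> U' \<and> U' \<subseteq> D \<and> D \<subseteq> U"
      using less.prems(5,6) unfolding neighbourhood_base_of by simp
    then obtain U' D where U': "openin K U'" "closedin K D" "x \<in> U'" "U' \<subseteq> D" "D \<subseteq> U"
      by blast
    obtain V where V: "\<And>n. openin K (V n)" "\<And>n. V n \<subseteq> U'" "\<And>n. x \<notin> V n"
        "\<And>n. V n \<inter> CB_derivative K (a n) \<noteq> {}" "disjoint_family V"
      by (rule CB_derivative_disjoint_neighbourhoods[where a = a, OF K(2) a(1) less.prems(7) U'(1,3)])
        (rule that; blast)
    have "\<exists>C \<phi>. closedin K C \<and> C \<subseteq> V n \<and> continuous_map (subtopology K C) X \<phi> \<and> \<phi> ` C = B n"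
      for n
    proof (cases "B n = {}")
      case True
      have "continuous_map (subtopology K {}) X (\<lambda>y. p)"
        using p by simp
      with True show ?thesis
        by (intro exI[of _ "{}"] exI[of _ "\<lambda>y. p"]) auto
    next
      case False
      then obtain q where q: "q \<in> B n" "a n = r q" "\<forall>u\<in>B n - {q}. r u < r q"
        using a(2) by blast
      have "openin X (B n)" "closedin X (B n)"
        using False B(1)[of n] unfolding \<G>_def by auto
      moreover obtain y where "y \<in> V n" "y \<in> CB_derivative K (r q)"
        using V(4)[of n] q(2) by auto
      moreover have "r q < r p"
        using a(1)[of n] q(2) by simp
      moreover have "\<And>u. u \<in> B n - {q} \<Longrightarrow> r u < r q"
        using q(3) by blast
      ultimately show ?thesis
        using less.hyps[of q "B n" "V n"] q(1) V(1) by blast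
    qed
    then obtain C \<phi> where C: "\<And>n. closedin K (C n)" "\<And>n. C n \<subseteq> V n"
      "\<And>n. continuous_map (subtopology K (C n)) X (\<phi> n)" "\<And>n. \<phi> n ` C n = B n"
      by metis
    obtain C' \<phi>' where "closedin K C'" "C' \<subseteq> D" "continuous_map (subtopology K C') X \<phi>'"
      "\<phi>' ` C' = insert p (\<Union>n. \<phi> n ` C n)"
    proof (rule glue_converging_maps)
      show "closedin K D" "x \<in> D" "\<And>n. x \<notin> V n" "p \<in> topspace X" "\<And>n. openin K (V n)"
        "disjoint_family V"
        using U' V(1,3,5) p by auto
      show "V n \<subseteq> D" for n
        using V(2) U'(4) by (rule subset_trans)
      show "finite {n. \<not> \<phi> n ` C n \<subseteq> W}" if "openin X W" "p \<in> W" for W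
        using B(3)[OF that] by (simp add: C(4))
    qed (use C in auto)
    moreover have "insert p (\<Union>n. \<phi> n ` C n) = N"
      using B(2) less.prems(3) by (auto simp: C(4))
    ultimately show ?thesis
      using U'(5) by blast
  qed
qed


subsection \<open>Interpolation across the gaps of a compact set of reals\<close>

definition gap_left :: "real set \<Rightarrow> real \<Rightarrow> real"
  where "gap_left S x = Sup (S \<inter> {..x})"

definition gap_right :: "real set \<Rightarrow> real \<Rightarrow> real"
  where "gap_right S x = Inf (S \<inter> {x..})"

text \<open>At points of \<open>S\<close> both ends coincide and the quotient, a division by zero,
  would be \<open>0\<close>; hence the separate case.\<close>

definition gap_interpolation :: "real set \<Rightarrow> (real \<Rightarrow> real) \<Rightarrow> real \<Rightarrow> real"
  where "gap_interpolation S f x =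
    (let p = gap_left S x; q = gap_right S x
     in if p = q then f p else ((q - x) * f p + (x - p) * f q) / (q - p))"

lemma gap_interpolation_add:
  "gap_interpolation S (\<lambda>x. f x + g x) x = gap_interpolation S f x + gap_interpolation S g x"
  by (simp add: gap_interpolation_def Let_def add_divide_distrib [symmetric] algebra_simps)

lemma gap_interpolation_mult:
  "gap_interpolation S (\<lambda>x. c * f x) x = c * gap_interpolation S f x"
  by (simp add: gap_interpolation_def Let_def algebra_simps)

context
  fixes S :: "real set"
  assumes S: "compact S" "S \<noteq> {}"
begin

lemma compact_Inf_Sup: "Inf S \<in> S" "Sup S \<in> S" "S \<subseteq> {Inf S..Sup S}"
proof -
  have "bdd_above S" "bdd_below S" "closed S"
    using S(1) by (auto intro: bounded_imp_bdd_above bounded_imp_bdd_below compact_imp_bounded compact_imp_closed)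
  then show "Inf S \<in> S" "Sup S \<in> S" "S \<subseteq> {Inf S..Sup S}"
    using S(2) by (auto intro: closed_contains_Inf closed_contains_Sup cInf_lower cSup_upper)
qed

lemma gap_left:
  assumes "x \<in> {Inf S..Sup S}"
  shows "gap_left S x \<in> S" "gap_left S x \<le> x" "\<And>s. s \<in> S \<Longrightarrow> s \<le> x \<Longrightarrow> s \<le> gap_left S x"
proof -
  have "closed (S \<inter> {..x})" "bdd_above (S \<inter> {..x})" "S \<inter> {..x} \<noteq> {}"
    using S(1) assms compact_Inf_Sup(1) by (auto intro: compact_imp_closed)
  then show "gap_left S x \<in> S" "gap_left S x \<le> x" "\<And>s. s \<in> S \<Longrightarrow> s \<le> x \<Longrightarrow> s \<le> gap_left S x"
    using closed_contains_Sup[of "S \<inter> {..x}"] cSup_upper[of _ "S \<inter> {..x}"]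
    by (auto simp: gap_left_def)
qed

lemma gap_right:
  assumes "x \<in> {Inf S..Sup S}"
  shows "gap_right S x \<in> S" "x \<le> gap_right S x" "\<And>s. s \<in> S \<Longrightarrow> x \<le> s \<Longrightarrow> gap_right S x \<le> s"
proof -
  have "closed (S \<inter> {x..})" "bdd_below (S \<inter> {x..})" "S \<inter> {x..} \<noteq> {}"
    using S(1) assms compact_Inf_Sup(2) by (auto intro: compact_imp_closed)
  then show "gap_right S x \<in> S" "x \<le> gap_right S x" "\<And>s. s \<in> S \<Longrightarrow> x \<le> s \<Longrightarrow> gap_right S x \<le> s"
    using closed_contains_Inf[of "S \<inter> {x..}"] cInf_lower[of _ "S \<inter> {x..}"]
    by (auto simp: gap_right_def)
qed

lemma gap_interpolation_on:
  assumes "x \<in> S"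
  shows "gap_interpolation S f x = f x"
proof -
  have "x \<in> {Inf S..Sup S}"
    using assms compact_Inf_Sup(3) by blast
  then have "gap_left S x = x" "gap_right S x = x"
    using assms gap_left gap_right by (meson antisym order_refl)+
  then show ?thesis
    by (simp add: gap_interpolation_def)
qed

text \<open>The weight \<open>v\<close> depends on \<open>x\<close> alone and not on
  \<open>f\<close>. Its relation to the position of \<open>x\<close> in the gap later bounds the
  influence of a distant endpoint.\<close>

lemma gap_interpolation_weight:
  assumes "x \<in> {Inf S..Sup S}"
  obtains v where "0 \<le> v" "v \<le> 1"
    "\<And>f. gap_interpolation S f x = (1 - v) * f (gap_left S x) + v * f (gap_right S x)"
    "v * (gap_right S x - gap_left S x) = x - gap_left S x"
proof (cases "gap_left S x = gap_right S x")
  case True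
  then have "x = gap_left S x"
    using gap_left(2)[OF assms] gap_right(2)[OF assms] by simp
  with True that[of 0] show thesis
    by (simp add: gap_interpolation_def)
next
  case False
  let ?p = "gap_left S x" and ?q = "gap_right S x"
  have pq: "?p \<le> x" "x \<le> ?q" "?p < ?q"
    using gap_left(2)[OF assms] gap_right(2)[OF assms] False by auto
  show thesis
  proof (rule that[of "(x - ?p) / (?q - ?p)"])
    show "gap_interpolation S f x
        = (1 - (x - ?p) / (?q - ?p)) * f ?p + (x - ?p) / (?q - ?p) * f ?q" for f
    proof -
      have "1 - (x - ?p) / (?q - ?p) = (?q - x) / (?q - ?p)"
        using pq by (simp add: field_simps)
      then show ?thesis
        using pq by (simp add: gap_interpolation_def Let_def add_divide_distrib)
    qed
  qed (use pq in \<open>auto simp: field_simps\<close>)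
qed

lemma abs_gap_interpolation_le:
  assumes "\<And>s. s \<in> S \<Longrightarrow> \<bar>f s\<bar> \<le> M" "x \<in> {Inf S..Sup S}"
  shows "\<bar>gap_interpolation S f x\<bar> \<le> M"
proof -
  obtain v where v: "0 \<le> v" "v \<le> 1"
    "gap_interpolation S f x = (1 - v) * f (gap_left S x) + v * f (gap_right S x)"
    by (metis gap_interpolation_weight[OF assms(2)])
  have "\<bar>gap_interpolation S f x\<bar> \<le> (1 - v) * \<bar>f (gap_left S x)\<bar> + v * \<bar>f (gap_right S x)\<bar>"
    using v by (simp add: abs_mult abs_triangle_ineq[THEN order_trans])
  also have "\<dots> \<le> M"
    using v assms gap_left(1) gap_right(1) by (intro convex_bound_le) auto
  finally show ?thesis .
qed

text \<open>Inside a gap the function is affine. For \<open>x\<close> near a point \<open>x0\<close>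
  of \<open>S\<close>, one end of the gap around \<open>x\<close> lies between \<open>x0\<close> and
  \<open>x\<close>; the other may be far away, but then its weight is small.\<close>

lemma continuous_on_gap_interpolation:
  assumes f: "continuous_on S f"
  shows "continuous_on {Inf S..Sup S} (gap_interpolation S f)"
  unfolding continuous_on_eq_continuous_within
proof
  fix x0
  assume x0: "x0 \<in> {Inf S..Sup S}"
  show "continuous (at x0 within {Inf S..Sup S}) (gap_interpolation S f)"
  proof (cases "x0 \<in> S")
    case False
    let ?p = "gap_left S x0" and ?q = "gap_right S x0"
    have pq: "?p \<in> S" "?q \<in> S" "?p < x0" "x0 < ?q"
      using gap_left[OF x0] gap_right[OF x0] False by (auto simp: less_le)
    have eq: "gap_interpolation S f x = ((?q - x) * f ?p + (x - ?p) * f ?q) / (?q - ?p)"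
      if x: "x \<in> {?p<..<?q}" for x
    proof -
      have x': "x \<in> {Inf S..Sup S}"
        using x pq compact_Inf_Sup(3) by (auto simp: subset_iff intro: order_trans less_imp_le)
      have "s \<le> ?p \<or> ?q \<le> s" if "s \<in> S" for s
        using gap_left(3)[OF x0 that] gap_right(3)[OF x0 that] by linarith
      then have "gap_left S x = ?p" "gap_right S x = ?q"
        using gap_left[OF x'] gap_right[OF x'] pq x
        by (metis antisym greaterThanLessThan_iff less_imp_le not_le order_trans)+
      then show ?thesis
        using pq by (simp add: gap_interpolation_def Let_def)
    qed
    have "eventually (\<lambda>x. x \<in> {?p<..<?q}) (nhds x0)"
      using pq by (intro eventually_nhds_in_open) auto
    then have "eventually (\<lambda>x. gap_interpolation S f x
        = ((?q - x) * f ?p + (x - ?p) * f ?q) / (?q - ?p)) (nhds x0)"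
      by (rule eventually_mono) (rule eq)
    moreover have "isCont (\<lambda>x. ((?q - x) * f ?p + (x - ?p) * f ?q) / (?q - ?p)) x0"
      using pq by (intro continuous_intros) auto
    ultimately have "isCont (gap_interpolation S f) x0"
      by (simp add: isCont_cong)
    then show ?thesis
      by (rule continuous_at_imp_continuous_at_within)
  next
    case True
    obtain M where M: "M > 0" "\<And>s. s \<in> S \<Longrightarrow> \<bar>f s\<bar> \<le> M"
      using compact_imp_bounded[OF compact_continuous_image[OF f S(1)]]
      by (auto simp: bounded_pos)
    show ?thesis
      unfolding continuous_within_eps_delta dist_real_def gap_interpolation_on[OF True]
    proof (intro allI impI)
      fix e :: real
      assume e: "0 < e"
      then obtain d where d: "d > 0" "\<And>s. s \<in> S \<Longrightarrow> \<bar>s - x0\<bar> < d \<Longrightarrow> \<bar>f s - f x0\<bar> < e / 2"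
        using f True half_gt_zero[OF e] unfolding continuous_on_iff dist_real_def by blast
      \<comment> \<open>If the far end is at distance at least \<open>d\<close> from
        \<open>x0\<close>, the bound \<open>d / 2\<close> makes the gap at least
        \<open>d / 2\<close> long, so the far weight is at most \<open>2 * d' / d\<close>. Values of
        \<open>f\<close> differ by at most \<open>2 * M\<close>, so
        \<open>8 * M * d' \<le> e * d\<close> limits the far contribution to
        \<open>e / 2\<close>.\<close>
      define d' where "d' = min (d / 2) (e * d / (8 * M))"
      have d': "0 < d'" "d' \<le> d / 2" "8 * M * d' \<le> e * d"
        using e d(1) M(1) by (auto simp: d'_def min_def field_simps)
      \<comment> \<open>Here \<open>A\<close> is the error at the end of the gap on the side of
        \<open>x0\<close>, and \<open>B\<close>, with weight \<open>v\<close>, the error at the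
        other end.\<close>
      have comb: "\<bar>(1 - v) * A + v * B\<bar> < e"
        if "\<bar>A\<bar> < e / 2" "\<bar>B\<bar> \<le> 2 * M" "0 \<le> v" "v \<le> 1" "\<bar>B\<bar> < e / 2 \<or> v * d \<le> 2 * d'"
        for v A B :: real
      proof -
        have "v * \<bar>B\<bar> \<le> e / 2"
          using that(5)
        proof
          assume "\<bar>B\<bar> < e / 2"
          then show ?thesis
            using mult_right_mono[OF that(4), of "\<bar>B\<bar>"] by simp
        next
          assume vd: "v * d \<le> 2 * d'"
          have "v * \<bar>B\<bar> * d \<le> v * (2 * M) * d"
            using that d(1) by (intro mult_right_mono mult_left_mono) auto
          also have "\<dots> \<le> 2 * M * (2 * d')"
            using mult_left_mono[OF vd, of "2 * M"] M(1) by (simp add: ac_simps)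
          also have "\<dots> \<le> e / 2 * d"
            using d'(3) by simp
          finally show ?thesis
            using d(1) by simp
        qed
        moreover have "(1 - v) * \<bar>A\<bar> \<le> \<bar>A\<bar>"
          using that by (simp add: mult_left_le_one_le)
        moreover have "\<bar>(1 - v) * A + v * B\<bar> \<le> (1 - v) * \<bar>A\<bar> + v * \<bar>B\<bar>"
          using that by (simp add: abs_mult abs_triangle_ineq[THEN order_trans])
        ultimately show ?thesis
          using that(1) by linarith
      qed
      have "\<bar>gap_interpolation S f x - f x0\<bar> < e"
        if x: "x \<in> {Inf S..Sup S}" "\<bar>x - x0\<bar> < d'" for x
      proof -
        let ?p = "gap_left S x" and ?q = "gap_right S x"
        obtain v where v: "0 \<le> v" "v \<le> 1"
            "gap_interpolation S f x = (1 - v) * f ?p + v * f ?q" "v * (?q - ?p) = x - ?p"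
          by (metis gap_interpolation_weight[OF x(1)])
        have pq: "?p \<in> S" "?q \<in> S" "?p \<le> x" "x \<le> ?q"
          using gap_left[OF x(1)] gap_right[OF x(1)] by auto
        have M2: "\<bar>f s - f x0\<bar> \<le> 2 * M" if "s \<in> S" for s
          using M(2)[OF that] M(2)[OF True] by linarith
        show ?thesis
        proof (cases "x0 \<le> x")
          case right: True
          then have p: "x0 \<le> ?p"
            using gap_left(3)[OF x(1) True] by simp
          have "\<bar>f ?p - f x0\<bar> < e / 2"
            using p pq x d'(2) d(1) by (intro d(2)) auto
          moreover have "\<bar>f ?q - f x0\<bar> < e / 2 \<or> v * d \<le> 2 * d'"
          proof (cases "?q < x0 + d")
            case True
            then show ?thesis
              using pq right d(2)[of ?q] by auto
          next
            case False
            then have "v * (d / 2) \<le> v * (?q - ?p)"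
              using pq x d'(2) v(1) by (intro mult_left_mono) auto
            also have "\<dots> \<le> d'"
              using v(4) p x right by auto
            finally show ?thesis
              by simp
          qed
          ultimately have "\<bar>(1 - v) * (f ?p - f x0) + v * (f ?q - f x0)\<bar> < e"
            using M2[OF pq(2)] v by (intro comb)
          then show ?thesis
            using v(3) by (simp add: algebra_simps)
        next
          case left: False
          \<comment> \<open>To the left of \<open>x0\<close> the right end is the near one, and the
            far weight is \<open>1 - v\<close>.\<close>
          then have q: "?q \<le> x0"
            using gap_right(3)[OF x(1) True] by simp
          have "\<bar>f ?q - f x0\<bar> < e / 2"
            using q pq x d'(2) d(1) by (intro d(2)) auto
          moreover have "\<bar>f ?p - f x0\<bar> < e / 2 \<or> (1 - v) * d \<le> 2 * d'"
          proof (cases "x0 - d < ?p")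
            case True
            then show ?thesis
              using pq left d(2)[of ?p] by auto
          next
            case False
            then have "(1 - v) * (d / 2) \<le> (1 - v) * (?q - ?p)"
              using pq x d'(2) v(2) by (intro mult_left_mono) auto
            also have "\<dots> = ?q - x"
              using v(4) by (simp add: algebra_simps)
            also have "\<dots> \<le> d'"
              using q x left by auto
            finally show ?thesis
              by simp
          qed
          ultimately have "\<bar>(1 - (1 - v)) * (f ?q - f x0) + (1 - v) * (f ?p - f x0)\<bar> < e"
            using M2[OF pq(1)] v by (intro comb) auto
          then show ?thesis
            using v(3) by (simp add: algebra_simps)
        qed
      qed
      then show "\<exists>d>0. \<forall>x\<in>{Inf S..Sup S}. \<bar>x - x0\<bar> < d \<longrightarrow> \<bar>gap_interpolation S f x - f x0\<bar> < e"
        using d'(1) by blast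
    qed
  qed
qed

end


subsection \<open>The order topology\<close>

text \<open>A member of the cover containing the right end \<open>c\<close> swallows some
  \<open>{t<..c}\<close>; what remains ends at \<open>t < c\<close>, and this descent is
  well-founded.\<close>

lemma compact_Icc_omega1: "compact {a..b :: omega1}"
  unfolding compact_eq_Heine_Borel
proof (intro allI impI)
  fix \<C> :: "omega1 set set"
  assume \<C>: "(\<forall>T\<in>\<C>. open T) \<and> {a..b} \<subseteq> \<Union>\<C>"
  have "c \<le> b \<Longrightarrow> \<exists>\<D>\<subseteq>\<C>. finite \<D> \<and> {a..c} \<subseteq> \<Union>\<D>" for c
  proof (induction c rule: less_induct)
    case (less c)
    show ?case
    proof (cases "a \<le> c")
      case True
      then obtain T where T: "T \<in> \<C>" "open T" "c \<in> T"
        using \<C> less.prems by fastforce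
      show ?thesis
      proof (cases "a = c")
        case True
        with T show ?thesis
          by (intro exI[of _ "{T}"]) auto
      next
        case False
        with \<open>a \<le> c\<close> have "a < c"
          by simp
        then obtain t where t: "t < c" "{t<..c} \<subseteq> T"
          using open_left[OF T(2,3), of a] by auto
        then obtain \<D> where "\<D> \<subseteq> \<C>" "finite \<D>" "{a..t} \<subseteq> \<Union>\<D>"
          using less.IH[of t] order_trans[OF less_imp_le less.prems] by blast
        moreover have "{a..c} \<subseteq> {a..t} \<union> {t<..c}"
          by auto
        ultimately show ?thesis
          using T(1) t(2) by (intro exI[of _ "insert T \<D>"]) auto
      qed
    next
      case False
      then show ?thesis
        by (intro exI[of _ "{}"]) auto
    qed
  qed
  then show "\<exists>\<D>\<subseteq>\<C>. finite \<D> \<and> {a..b} \<subseteq> \<Union>\<D>"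
    by blast
qed

lemma countable_Icc_omega1: "countable {a..b :: omega1}"
proof -
  have "{a..b} \<subseteq> {..<osuc b}"
    using osuc_greater[of b] by (auto intro: le_less_trans)
  then show ?thesis
    using countable_below countable_subset by blast
qed

text \<open>Successors turn a half-open interval into an open and a closed one at once; these clopen
  intervals form the boxes in the square.\<close>

lemma Ioc_omega1: "{a<..b :: omega1} = {a<..<osuc b}" "{a<..b} = {osuc a..b}"
  using osuc_le_iff[of b] osuc_le_iff[of a] by (auto simp: not_le[symmetric])

lemma open_Ioc_omega1: "open {a<..b :: omega1}"
  by (simp add: Ioc_omega1(1))

lemma closed_Ioc_omega1: "closed {a<..b :: omega1}"
  by (simp add: Ioc_omega1(2))

text \<open>The map gains 2^-n just after the n-th point of an enumeration of \<open>{..c}\<close>.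
  Each such step is continuous because \<open>{..a}\<close> and its complement
  \<open>{osuc a..}\<close> are both closed, and strictness at \<open>s < s'\<close> comes from an
  index of \<open>s\<close>.\<close>

lemma omega1_embeds_in_real:
  fixes c :: omega1
  obtains h :: "omega1 \<Rightarrow> real" where "continuous_on UNIV h" "strict_mono_on {..c} h"
proof -
  define d where "d = from_nat_into {..c}"
  have d: "range d = {..c}"
    unfolding d_def using countable_Icc_omega1[of 0 c] zero_le_omega1
    by (intro range_from_nat_into) (auto simp: atLeastAtMost_def atLeast_def)
  define t where "t n s = (1 / 2) ^ n * (if d n < s then 1 else 0 :: real)" for n s
  define h where "h s = suminf (\<lambda>n. t n s)" for s
  have t: "norm (t n s) \<le> (1 / 2) ^ n" for n s
    by (simp add: t_def)
  have summable: "summable (\<lambda>n. t n s)" for s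
    by (rule summable_comparison_test'[of "\<lambda>n. (1 / 2) ^ n"]) (use t in \<open>auto intro: summable_geometric\<close>)
  have ind: "continuous_on UNIV (\<lambda>s. if a < s then 1 else 0 :: real)" for a :: omega1
  proof -
    have "continuous_on ({osuc a..} \<union> {..a}) (\<lambda>s. if a < s then 1 else 0 :: real)"
      by (rule continuous_on_cases) (auto simp: osuc_le_iff)
    moreover have "{osuc a..} \<union> {..a} = UNIV"
      by (auto simp: osuc_le_iff)
    ultimately show ?thesis
      by simp
  qed
  have "uniform_limit UNIV (\<lambda>n s. \<Sum>i<n. t i s) h sequentially"
    unfolding h_def by (rule Weierstrass_m_test[where M = "\<lambda>n. (1 / 2) ^ n"]) (use t in auto)
  moreover have "continuous_on UNIV (\<lambda>s. \<Sum>i<n. t i s)" for n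
    unfolding t_def by (intro continuous_intros ind)
  ultimately have "continuous_on UNIV h"
    by (intro uniform_limit_theorem[where f = "\<lambda>n s. \<Sum>i<n. t i s" and F = sequentially]) auto
  moreover have "h s < h s'" if "s < s'" "s' \<le> c" for s s'
  proof -
    have "s \<in> range d"
      using that unfolding d by simp
    then obtain n where n: "d n = s"
      by blast
    have "0 < suminf (\<lambda>n. t n s' - t n s)"
      using that n by (intro suminf_pos2[of _ n] summable_diff summable) (auto simp: t_def)
    then show ?thesis
      by (simp add: h_def suminf_diff[OF summable summable, symmetric])
  qed
  ultimately show thesis
    using that by (simp add: strict_mono_on_def)
qed


subsection \<open>The supremum norm\<close>

lemma sup_norm_attained:
  assumes "compact_space X" "continuous_map X euclideanreal f" "topspace X \<noteq> {}"
  obtains x where "x \<in> topspace X" "sup_norm X f = \<bar>f x\<bar>"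
    "\<And>y. y \<in> topspace X \<Longrightarrow> \<bar>f y\<bar> \<le> \<bar>f x\<bar>"
proof -
  have "continuous_map X euclideanreal (\<lambda>x. \<bar>f x\<bar>)"
    using assms(2) by (rule continuous_map_real_abs)
  then have "compact ((\<lambda>x. \<bar>f x\<bar>) ` topspace X)"
    using assms(1) image_compactin unfolding compact_space_def by fastforce
  then obtain x where x: "x \<in> topspace X" "\<And>y. y \<in> topspace X \<Longrightarrow> \<bar>f y\<bar> \<le> \<bar>f x\<bar>"
    using compact_attains_sup[of "(\<lambda>x. \<bar>f x\<bar>) ` topspace X"] assms(3) by auto
  moreover have "sup_norm X f = \<bar>f x\<bar>"
    unfolding sup_norm_def using x by (intro cSup_eq_maximum) auto
  ultimately show thesis
    using that by blast
qed

lemma abs_le_sup_norm: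
  assumes "compact_space X" "continuous_map X euclideanreal f" "x \<in> topspace X"
  shows "\<bar>f x\<bar> \<le> sup_norm X f"
proof -
  have "topspace X \<noteq> {}"
    using assms(3) by blast
  then obtain y where "sup_norm X f = \<bar>f y\<bar>" "\<And>z. z \<in> topspace X \<Longrightarrow> \<bar>f z\<bar> \<le> \<bar>f y\<bar>"
    using sup_norm_attained[OF assms(1,2)] by metis
  then show ?thesis
    using assms(3) by simp
qed

lemma sup_norm_le: "(\<And>x. x \<in> topspace X \<Longrightarrow> \<bar>f x\<bar> \<le> M) \<Longrightarrow> 0 \<le> M \<Longrightarrow> sup_norm X f \<le> M"
  unfolding sup_norm_def by (intro cSup_least) auto

lemma C_space_add: "f \<in> C_space X \<Longrightarrow> g \<in> C_space X \<Longrightarrow> (\<lambda>x. f x + g x) \<in> C_space X"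
  by (simp add: C_space_def continuous_map_add)

lemma C_space_mult: "f \<in> C_space X \<Longrightarrow> (\<lambda>x. c * f x) \<in> C_space X"
  by (simp add: C_space_def continuous_map_real_mult_left)

lemma C_space_diff: "f \<in> C_space X \<Longrightarrow> g \<in> C_space X \<Longrightarrow> (\<lambda>x. f x - g x) \<in> C_space X"
  by (simp add: C_space_def continuous_map_diff)


subsection \<open>Averages over pairs of points\<close>

text \<open>If \<open>T f\<close> takes the value \<open>(f s + f t) / 2\<close> for all \<open>s, t\<close>, then given \<open>u, v\<close> peaking at
  \<open>s, t\<close>, one of the pairs \<open>(s, s)\<close>, \<open>(t, t)\<close>, \<open>(s, t)\<close> yields a point at which both
  \<open>T u\<close> and \<open>T v\<close> are at least a third of the smaller norm.\<close>

lemma averaging_embedding_SPR: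
  fixes L :: "'l topology" and K :: "'k topology"
  assumes L: "compact_space L" "topspace L \<noteq> {}" and K: "compact_space K"
    and T_C: "\<And>f. f \<in> C_space L \<Longrightarrow> T f \<in> C_space K"
    and T_add: "\<And>f g. f \<in> C_space L \<Longrightarrow> g \<in> C_space L \<Longrightarrow> T (\<lambda>x. f x + g x) = (\<lambda>y. T f y + T g y)"
    and T_mult: "\<And>c f. f \<in> C_space L \<Longrightarrow> T (\<lambda>x. c * f x) = (\<lambda>y. c * T f y)"
    and T_le: "\<And>f M y. f \<in> C_space L \<Longrightarrow> (\<And>x. x \<in> topspace L \<Longrightarrow> \<bar>f x\<bar> \<le> M) \<Longrightarrow> 0 \<le> M \<Longrightarrow>
      y \<in> topspace K \<Longrightarrow> \<bar>T f y\<bar> \<le> M"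
    and T_average: "\<And>s t. s \<in> topspace L \<Longrightarrow> t \<in> topspace L \<Longrightarrow>
      \<exists>y\<in>topspace K. \<forall>f\<in>C_space L. T f y = (f s + f t) / 2"
  shows "linear_isometric_embedding L K T \<and> does_SPR 3 K (T ` C_space L)"
proof -
  have cont: "continuous_map L euclideanreal f" if "f \<in> C_space L" for f
    using that by (simp add: C_space_def)
  have T_diff: "T (\<lambda>x. f x - g x) = (\<lambda>y. T f y - T g y)"
    if "f \<in> C_space L" "g \<in> C_space L" for f g
    using T_add[OF that(1) C_space_mult[OF that(2), of "-1"]] T_mult[OF that(2), of "-1"] by simp
  have isometric: "sup_norm K (T f) = sup_norm L f" if f: "f \<in> C_space L" for f
  proof (rule antisym)
    obtain s where s: "s \<in> topspace L" "sup_norm L f = \<bar>f s\<bar>"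
        "\<And>x. x \<in> topspace L \<Longrightarrow> \<bar>f x\<bar> \<le> \<bar>f s\<bar>"
      using sup_norm_attained[OF L(1) cont[OF f] L(2)] by blast
    show "sup_norm K (T f) \<le> sup_norm L f"
      unfolding s(2) using T_le[OF f s(3)] by (intro sup_norm_le) auto
    \<comment> \<open>The diagonal pair \<open>(s, s)\<close> reproduces \<open>f s\<close>, so
      averaging loses no norm.\<close>
    obtain y where y: "y \<in> topspace K" "T f y = (f s + f s) / 2"
      using T_average[OF s(1) s(1)] f by blast
    then have "sup_norm L f = \<bar>T f y\<bar>"
      by (simp add: s(2))
    also have "\<dots> \<le> sup_norm K (T f)"
      using K T_C[OF f] y(1) by (intro abs_le_sup_norm) (auto simp: C_space_def)
    finally show "sup_norm L f \<le> sup_norm K (T f)" .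
  qed
  then have "linear_isometric_embedding L K T"
    using T_C T_add T_mult by (auto simp: linear_isometric_embedding_def)
  moreover have "C_subspace K (T ` C_space L)"
    unfolding C_subspace_def
  proof (intro conjI ballI allI)
    show "T ` C_space L \<subseteq> C_space K"
      using T_C by blast
    have 0: "(\<lambda>x. 0) \<in> C_space L"
      by (simp add: C_space_def)
    then have "T (\<lambda>x. 0) = (\<lambda>x. 0)"
      using T_mult[OF 0, of 0] by simp
    with 0 show "(\<lambda>x. 0) \<in> T ` C_space L"
      by (metis image_eqI)
    show "(\<lambda>x. f x + g x) \<in> T ` C_space L" if "f \<in> T ` C_space L" "g \<in> T ` C_space L" for f g
      using that T_add[symmetric] C_space_add by fastforce
    show "(\<lambda>x. c * f x) \<in> T ` C_space L" if "f \<in> T ` C_space L" for c f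
      using that T_mult[symmetric] C_space_mult by fastforce
  qed
  moreover have "min (sup_norm K (\<lambda>x. T f x - T g x)) (sup_norm K (\<lambda>x. T f x + T g x))
      \<le> 3 * sup_norm K (\<lambda>x. \<bar>T f x\<bar> - \<bar>T g x\<bar>)"
    if fg: "f \<in> C_space L" "g \<in> C_space L" for f g
  proof -
    define u v where "u = (\<lambda>x. f x - g x)" and "v = (\<lambda>x. f x + g x)"
    have uv: "u \<in> C_space L" "v \<in> C_space L"
      using fg by (auto simp: u_def v_def intro: C_space_add C_space_diff)
    have Tuv: "T u = (\<lambda>x. T f x - T g x)" "T v = (\<lambda>x. T f x + T g x)"
      using fg by (simp_all add: u_def v_def T_add T_diff)
    define m where "m = min (sup_norm L u) (sup_norm L v)"
    obtain s where s: "s \<in> topspace L" "sup_norm L u = \<bar>u s\<bar>"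
      using sup_norm_attained[OF L(1) cont[OF uv(1)] L(2)] by blast
    obtain t where t: "t \<in> topspace L" "sup_norm L v = \<bar>v t\<bar>"
      using sup_norm_attained[OF L(1) cont[OF uv(2)] L(2)] by blast
    have m: "0 \<le> m" "m \<le> \<bar>u s\<bar>" "m \<le> \<bar>v t\<bar>"
      using s(2) t(2) by (auto simp: m_def)
    have "\<exists>a\<in>topspace L. \<exists>b\<in>topspace L. m / 3 \<le> \<bar>(u a + u b) / 2\<bar> \<and> m / 3 \<le> \<bar>(v a + v b) / 2\<bar>"
    proof (cases "m / 3 \<le> \<bar>v s\<bar>")
      case True
      then show ?thesis
        using s(1) m by (intro bexI[of _ s]) auto
    next
      case v: False
      show ?thesis
      proof (cases "m / 3 \<le> \<bar>u t\<bar>")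
        case True
        then show ?thesis
          using t(1) m by (intro bexI[of _ t]) auto
      next
        case False
        have "m / 3 \<le> \<bar>(x + y) / 2\<bar>" if "m \<le> \<bar>x\<bar>" "\<not> m / 3 \<le> \<bar>y\<bar>" for x y :: real
        proof -
          have "\<bar>x\<bar> \<le> \<bar>x + y\<bar> + \<bar>y\<bar>"
            by simp
          with that have "m \<le> \<bar>x + y\<bar> + m / 3"
            by simp
          then show ?thesis
            by simp
        qed
        from this[OF m(2) False] this[OF m(3) v] show ?thesis
          using s(1) t(1) by (intro bexI[of _ s] bexI[of _ t]) (auto simp: add.commute)
      qed
    qed
    then obtain a b where ab: "a \<in> topspace L" "b \<in> topspace L"
        "m / 3 \<le> \<bar>(u a + u b) / 2\<bar>" "m / 3 \<le> \<bar>(v a + v b) / 2\<bar>"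
      by blast
    obtain y where y: "y \<in> topspace K" "\<forall>f\<in>C_space L. T f y = (f a + f b) / 2"
      using T_average[OF ab(1,2)] by blast
    then have "m / 3 \<le> \<bar>T f y - T g y\<bar>" "m / 3 \<le> \<bar>T f y + T g y\<bar>"
      using ab uv Tuv by (metis (no_types))+
    then have "m / 3 \<le> \<bar>\<bar>T f y\<bar> - \<bar>T g y\<bar>\<bar>"
      by (auto simp: abs_if split: if_splits)
    also have "\<dots> \<le> sup_norm K (\<lambda>x. \<bar>T f x\<bar> - \<bar>T g x\<bar>)"
      using K y(1) T_C[OF fg(1)] T_C[OF fg(2)]
      by (intro abs_le_sup_norm[where f = "\<lambda>x. \<bar>T f x\<bar> - \<bar>T g x\<bar>"] continuous_map_diff
          continuous_map_real_abs) (auto simp: C_space_def)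
    finally have "m \<le> 3 * sup_norm K (\<lambda>x. \<bar>T f x\<bar> - \<bar>T g x\<bar>)"
      by simp
    then show ?thesis
      using isometric[OF uv(1)] isometric[OF uv(2)] by (simp add: m_def Tuv)
  qed
  ultimately show ?thesis
    by (auto simp: does_SPR_def)
qed


subsection \<open>The square of an ordinal interval\<close>

text \<open>As \<open>ord_rank\<close> is bounded only from above, its value at the top is
  overridden to be exactly \<beta>. The strict decrease persists, since all other points already
  have rank below \<beta>.\<close>

lemma oexp_interval_rank:
  obtains \<rho> where "\<rho> (oexp \<omega> \<beta>) = \<beta>" "\<And>u. 0 < u \<Longrightarrow> u < oexp \<omega> \<beta> \<Longrightarrow> \<rho> u < \<beta>"
    "\<And>s. 0 < s \<Longrightarrow> s \<le> oexp \<omega> \<beta> \<Longrightarrow> \<exists>t<s. \<forall>u\<in>{t<..<s}. \<rho> u < \<rho> s"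
proof -
  define \<rho> where "\<rho> u = (if u = oexp \<omega> \<beta> then \<beta> else ord_rank u)" for u
  have less: "\<rho> u < \<beta>" if "0 < u" "u < oexp \<omega> \<beta>" for u
    using ord_rank_less_of_less_oexp[OF that] that by (simp add: \<rho>_def)
  have "\<exists>t<s. \<forall>u\<in>{t<..<s}. \<rho> u < \<rho> s" if s: "0 < s" "s \<le> oexp \<omega> \<beta>" for s
  proof (cases "s = oexp \<omega> \<beta>")
    case True
    then show ?thesis
      using s(1) less by (intro exI[of _ 0]) (auto simp: \<rho>_def)
  next
    case False
    obtain t where "t < s" "\<And>u. t < u \<Longrightarrow> u < s \<Longrightarrow> ord_rank u < ord_rank s"
      using ord_rank_lessE[OF s(1)] by blast
    then show ?thesis
      using False s(2) by (intro exI[of _ t]) (auto simp: \<rho>_def)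
  qed
  with less show thesis
    by (intro that[of \<rho>]) (auto simp: \<rho>_def)
qed

text \<open>In a box \<open>{a<..s} \<times> {b<..t}\<close> the centre is the top corner. Any other
  point differs from it in some coordinate, whose rank is then strictly smaller, while the other
  rank does not increase.\<close>

lemma clopen_rank_base_square:
  fixes \<rho> :: "omega1 \<Rightarrow> omega1"
  assumes \<rho>: "\<And>s. s \<in> {1..c} \<Longrightarrow> \<exists>t<s. \<forall>u\<in>{t<..<s}. \<rho> u < \<rho> s"
    and W: "openin (top_of_set ({1..c} \<times> {1..c})) W" "q \<in> W"
  shows "\<exists>G. openin (top_of_set ({1..c} \<times> {1..c})) G \<and> closedin (top_of_set ({1..c} \<times> {1..c})) G \<and>
    q \<in> G \<and> G \<subseteq> W \<and> (\<forall>u\<in>G - {q}. hessenberg_sum (\<rho> (fst u)) (\<rho> (snd u))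
      < hessenberg_sum (\<rho> (fst q)) (\<rho> (snd q)))"
proof -
  let ?L = "{1..c}"
  obtain s t where q: "q = (s, t)"
    by fastforce
  obtain O' where O': "open O'" "W = ?L \<times> ?L \<inter> O'"
    using W(1) by (auto simp: openin_open)
  obtain A B where AB: "open A" "open B" "(s, t) \<in> A \<times> B" "A \<times> B \<subseteq> O'"
    using open_prod_elim[OF O'(1), of q] W(2) O'(2) q by blast
  have st: "s \<in> ?L" "t \<in> ?L"
    using W(2) O'(2) q by auto
  have nbhd: "\<exists>a<s. {a<..s} \<subseteq> A \<and> (\<forall>u\<in>{a<..<s}. \<rho> u < \<rho> s)"
    if sA: "s \<in> ?L" "open A" "s \<in> A" for s and A :: "omega1 set"
  proof -
    have "0 < s"
      using sA(1) by (simp add: one_le_iff)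
    then obtain a where "a < s" "{a<..s} \<subseteq> A"
      using open_left[OF sA(2,3)] by blast
    moreover obtain a' where "a' < s" "\<forall>u\<in>{a'<..<s}. \<rho> u < \<rho> s"
      using \<rho>[OF sA(1)] by blast
    ultimately show ?thesis
      by (intro exI[of _ "max a a'"]) (auto simp: subset_iff)
  qed
  obtain a where a: "a < s" "{a<..s} \<subseteq> A" "\<forall>u\<in>{a<..<s}. \<rho> u < \<rho> s"
    using nbhd[OF st(1) AB(1)] AB(3) by auto
  obtain b where b: "b < t" "{b<..t} \<subseteq> B" "\<forall>u\<in>{b<..<t}. \<rho> u < \<rho> t"
    using nbhd[OF st(2) AB(2)] AB(3) by auto
  define G where "G = ?L \<times> ?L \<inter> {a<..s} \<times> {b<..t}"
  have "openin (top_of_set (?L \<times> ?L)) G" "closedin (top_of_set (?L \<times> ?L)) G"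
    unfolding G_def by (auto intro!: openin_open_Int closedin_closed_Int open_Times closed_Times
        open_Ioc_omega1 closed_Ioc_omega1)
  moreover have "q \<in> G" "G \<subseteq> W"
    using st a b AB(4) O'(2) by (auto simp: G_def q)
  moreover have "hessenberg_sum (\<rho> x) (\<rho> y) < hessenberg_sum (\<rho> s) (\<rho> t)"
    if "(x, y) \<in> G - {(s, t)}" for x y
  proof -
    have "x = s \<or> \<rho> x < \<rho> s" "y = t \<or> \<rho> y < \<rho> t" "x \<noteq> s \<or> y \<noteq> t"
      using that a(3) b(3) by (auto simp: G_def)
    then show ?thesis
      by (intro hessenberg_sum_strict_mono) auto
  qed
  ultimately show ?thesis
    unfolding q by (intro exI[of _ G]) fastforce
qed

lemma maps_onto_oexp_square:
  fixes K :: "'k topology"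
  assumes K: "compact_space K" "Hausdorff_space K"
    and "CB_derivative K (hessenberg_double \<alpha>) \<noteq> {}"
  obtains C \<phi> where "closedin K C"
    "continuous_map (subtopology K C) (top_of_set ({1..oexp \<omega> \<alpha>} \<times> {1..oexp \<omega> \<alpha>})) \<phi>"
    "\<phi> ` C = {1..oexp \<omega> \<alpha>} \<times> {1..oexp \<omega> \<alpha>}"
proof -
  let ?c = "oexp \<omega> \<alpha>"
  let ?L = "{1..?c}"
  let ?X = "top_of_set (?L \<times> ?L)"
  obtain \<rho> where \<rho>: "\<rho> ?c = \<alpha>" "\<And>u. 0 < u \<Longrightarrow> u < ?c \<Longrightarrow> \<rho> u < \<alpha>"
    "\<And>s. 0 < s \<Longrightarrow> s \<le> ?c \<Longrightarrow> \<exists>t<s. \<forall>u\<in>{t<..<s}. \<rho> u < \<rho> s"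
    using oexp_interval_rank[of \<alpha>] by blast
  define r where "r = (\<lambda>q. hessenberg_sum (\<rho> (fst q)) (\<rho> (snd q)))"
  have r_top: "r (?c, ?c) = hessenberg_double \<alpha>"
    by (simp add: r_def hessenberg_double_def \<rho>(1))
  obtain x where x: "x \<in> CB_derivative K (r (?c, ?c))"
    using assms(3) by (auto simp: r_top)
  have "Hausdorff_space (euclidean :: (omega1 \<times> omega1) topology)"
    unfolding Hausdorff_space_def disjnt_def open_openin[symmetric]
    by (meson hausdorff)
  then have "t1_space ?X"
    by (intro Hausdorff_imp_t1_space Hausdorff_space_subtopology)
  moreover have "compact_space ?X"
    using compact_Times[OF compact_Icc_omega1 compact_Icc_omega1]
    by (simp add: compact_space_subtopology)
  moreover have "countable (topspace ?X)"
    by (simp add: countable_Icc_omega1)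
  moreover have "\<exists>G. openin ?X G \<and> closedin ?X G \<and> q \<in> G \<and> G \<subseteq> W \<and> (\<forall>u\<in>G - {q}. r u < r q)"
    if "openin ?X W" "q \<in> W" for q W
    unfolding r_def by (rule clopen_rank_base_square[OF _ that]) (use \<rho>(3) in \<open>auto simp: one_le_iff\<close>)
  moreover have "openin ?X (?L \<times> ?L)" "closedin ?X (?L \<times> ?L)"
    by auto
  moreover have "(?c, ?c) \<in> ?L \<times> ?L"
    by (simp add: one_le_iff oexp_pos)
  \<comment> \<open>This admits the whole square as the clopen set \<open>N\<close> around its
    corner.\<close>
  moreover have "r q < r (?c, ?c)" if q: "q \<in> ?L \<times> ?L - {(?c, ?c)}" for q
  proof -
    obtain s t where st: "q = (s, t)" "s \<in> ?L" "t \<in> ?L"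
      using q by auto
    have ne: "s \<noteq> ?c \<or> t \<noteq> ?c"
      using q st(1) by auto
    have "u = ?c \<or> \<rho> u < \<alpha>" if "u \<in> ?L" for u
      using that \<rho>(2)[of u] by (cases "u = ?c") (simp_all add: one_le_iff order.strict_iff_order)
    from ne this[OF st(2)] this[OF st(3)] show ?thesis
      unfolding r_def st(1) fst_conv snd_conv
      by (intro hessenberg_sum_strict_mono) (auto simp: \<rho>(1))
  qed
  moreover have "openin K (topspace K)" "x \<in> topspace K"
    using subsetD[OF CB_derivative_subset_topspace x] by simp_all
  ultimately have "\<exists>C \<phi>. closedin K C \<and> C \<subseteq> topspace K \<and> continuous_map (subtopology K C) ?X \<phi> \<and>
      \<phi> ` C = ?L \<times> ?L"
    using x by (intro CB_derivative_maps_onto_scattered[OF K, where r = r])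
  with that show thesis
    by blast
qed


subsection \<open>The embedding\<close>

text \<open>Tietze's theorem is applied once, to the coordinate, and not to each \<open>f\<close>;
  since \<open>f\<close> enters only through the interpolation, \<open>E\<close> is linear.
  Interpolated values are convex combinations of values of \<open>f\<close>, which gives the
  bound.\<close>

lemma real_extension_operator:
  fixes K :: "'k topology" and c :: omega1
  assumes K: "normal_space K" "closedin K C"
    and \<psi>: "continuous_map (subtopology K C) (top_of_set {1..c}) \<psi>" and c: "1 \<le> c"
  obtains E :: "(omega1 \<Rightarrow> real) \<Rightarrow> 'k \<Rightarrow> real" where
    "\<And>f. continuous_on {1..c} f \<Longrightarrow> continuous_map K euclideanreal (E f)"
    "\<And>f g y. E (\<lambda>x. f x + g x) y = E f y + E g y" "\<And>k f y. E (\<lambda>x. k * f x) y = k * E f y"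
    "\<And>f y. y \<in> C \<Longrightarrow> E f y = f (\<psi> y)"
    "\<And>f M y. (\<And>s. s \<in> {1..c} \<Longrightarrow> \<bar>f s\<bar> \<le> M) \<Longrightarrow> y \<in> topspace K \<Longrightarrow> \<bar>E f y\<bar> \<le> M"
proof -
  let ?L = "{1..c}"
  obtain h :: "omega1 \<Rightarrow> real" where h: "continuous_on UNIV h" "strict_mono_on {..c} h"
    by (rule omega1_embeds_in_real)
  define S where "S = h ` ?L"
  have h_L: "continuous_on ?L h"
    using h(1) continuous_on_subset by blast
  have S: "compact S" "S \<noteq> {}"
    unfolding S_def using compact_continuous_image[OF h_L compact_Icc_omega1] c by auto
  have inj: "inj_on h ?L"
    using strict_mono_on_imp_inj_on[OF h(2)] by (rule inj_on_subset) auto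
  define g where "g = the_inv_into ?L h"
  have g: "g (h s) = s" if "s \<in> ?L" for s
    unfolding g_def using inj that by (rule the_inv_into_f_f)
  have g_cont: "continuous_on S g" "g ` S \<subseteq> ?L"
    unfolding S_def using continuous_on_inv[OF h_L compact_Icc_omega1] g by auto
  have C: "topspace (subtopology K C) = C"
    using closedin_subset[OF K(2)] by auto
  then have \<psi>_in: "\<psi> y \<in> ?L" if "y \<in> C" for y
    using \<psi> that by (auto simp: continuous_map_in_subtopology)
  have "continuous_map (subtopology K C) euclideanreal (h \<circ> \<psi>)"
    using \<psi> by (rule continuous_map_compose) (simp add: h_L)
  \<comment> \<open>Confining the extension to this interval ensures that each of its values lies in
    \<open>S\<close> or in a gap with two endpoints in \<open>S\<close>.\<close>
  moreover have "(h \<circ> \<psi>) ` C \<subseteq> {Inf S..Sup S}"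
    using \<psi>_in compact_Inf_Sup(3)[OF S] by (auto simp: S_def)
  moreover have "Inf S \<le> Sup S"
    using compact_Inf_Sup[OF S] by auto
  ultimately obtain H where H: "continuous_map K euclideanreal H"
    "\<And>y. y \<in> C \<Longrightarrow> H y = (h \<circ> \<psi>) y" "H ` topspace K \<subseteq> {Inf S..Sup S}"
    by (rule Tietze_extension_closed_real_interval[OF K]) (rule that; blast)
  define E where "E f y = gap_interpolation S (\<lambda>x. f (g x)) (H y)" for f y
  show thesis
  proof (rule that)
    show "continuous_map K euclideanreal (E f)" if "continuous_on ?L f" for f
    proof -
      have "continuous_on S (\<lambda>x. f (g x))"
        using continuous_on_compose2[OF that g_cont] .
      then have "continuous_on {Inf S..Sup S} (gap_interpolation S (\<lambda>x. f (g x)))"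
        by (rule continuous_on_gap_interpolation[OF S])
      moreover have "continuous_map K (top_of_set {Inf S..Sup S}) H"
        using H(1,3) by (simp add: continuous_map_in_subtopology image_subset_iff_funcset)
      ultimately have "continuous_map K euclideanreal (gap_interpolation S (\<lambda>x. f (g x)) \<circ> H)"
        by (intro continuous_map_compose) auto
      then show ?thesis
        by (simp add: E_def [abs_def] comp_def)
    qed
    show "E (\<lambda>x. f x + g x) y = E f y + E g y" for f g y
      by (simp add: E_def gap_interpolation_add)
    show "E (\<lambda>x. k * f x) y = k * E f y" for k f y
      by (simp add: E_def gap_interpolation_mult)
    show "E f y = f (\<psi> y)" if "y \<in> C" for f y
      using gap_interpolation_on[OF S, of "H y"] H(2)[OF that] \<psi>_in[OF that] g
      by (simp add: E_def S_def)
    show "\<bar>E f y\<bar> \<le> M" if "\<And>s. s \<in> ?L \<Longrightarrow> \<bar>f s\<bar> \<le> M" "y \<in> topspace K" for f M y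
      unfolding E_def using that g_cont(2) H(3)
      by (intro abs_gap_interpolation_le[OF S]) auto
  qed
qed

theorem theorem1p5:
  fixes K :: "'k topology" and \<alpha> :: omega1
  assumes "compact_space K" and "Hausdorff_space K"
    and "CB_derivative K (hessenberg_double \<alpha>) \<noteq> {}"
  shows "\<exists>T. linear_isometric_embedding (ord_interval (oexp \<omega> \<alpha>)) K T \<and>
             does_SPR 3 K (T ` C_space (ord_interval (oexp \<omega> \<alpha>)))"
proof -
  let ?c = "oexp \<omega> \<alpha>"
  let ?L = "{1..?c}"
  have c: "1 \<le> ?c"
    by (simp add: one_le_iff oexp_pos)
  have normal: "normal_space K"
    using assms(1,2) by (simp add: compact_Hausdorff_or_regular_imp_normal_space)
  obtain C \<phi> where C: "closedin K C" "\<phi> ` C = ?L \<times> ?L"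
    and \<phi>: "continuous_map (subtopology K C) (top_of_set (?L \<times> ?L)) \<phi>"
    by (rule maps_onto_oexp_square[OF assms])
  have prod: "top_of_set (?L \<times> ?L) = prod_topology (top_of_set ?L) (top_of_set ?L)"
    by (simp add: prod_topology_subtopology_eu)
  have fst_snd: "continuous_map (subtopology K C) (top_of_set ?L) (fst \<circ> \<phi>)"
    "continuous_map (subtopology K C) (top_of_set ?L) (snd \<circ> \<phi>)"
    using \<phi> unfolding prod continuous_map_pairwise by auto
  obtain E1 where E1: "\<And>f. continuous_on ?L f \<Longrightarrow> continuous_map K euclideanreal (E1 f)"
    "\<And>f g y. E1 (\<lambda>x. f x + g x) y = E1 f y + E1 g y" "\<And>k f y. E1 (\<lambda>x. k * f x) y = k * E1 f y"
    "\<And>f y. y \<in> C \<Longrightarrow> E1 f y = f ((fst \<circ> \<phi>) y)"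
    "\<And>f M y. (\<And>s. s \<in> ?L \<Longrightarrow> \<bar>f s\<bar> \<le> M) \<Longrightarrow> y \<in> topspace K \<Longrightarrow> \<bar>E1 f y\<bar> \<le> M"
    by (rule real_extension_operator[OF normal C(1) fst_snd(1) c]) (rule that; blast)
  obtain E2 where E2: "\<And>f. continuous_on ?L f \<Longrightarrow> continuous_map K euclideanreal (E2 f)"
    "\<And>f g y. E2 (\<lambda>x. f x + g x) y = E2 f y + E2 g y" "\<And>k f y. E2 (\<lambda>x. k * f x) y = k * E2 f y"
    "\<And>f y. y \<in> C \<Longrightarrow> E2 f y = f ((snd \<circ> \<phi>) y)"
    "\<And>f M y. (\<And>s. s \<in> ?L \<Longrightarrow> \<bar>f s\<bar> \<le> M) \<Longrightarrow> y \<in> topspace K \<Longrightarrow> \<bar>E2 f y\<bar> \<le> M"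
    by (rule real_extension_operator[OF normal C(1) fst_snd(2) c]) (rule that; blast)
  \<comment> \<open>The value zero off the space is the normalisation required by
    \<open>C_space\<close>.\<close>
  define T where "T f y = (if y \<in> topspace K then (E1 f y + E2 f y) / 2 else 0)" for f y
  have C_K: "C \<subseteq> topspace K"
    by (rule closedin_subset[OF C(1)])
  have "linear_isometric_embedding (ord_interval ?c) K T \<and> does_SPR 3 K (T ` C_space (ord_interval ?c))"
  proof (rule averaging_embedding_SPR)
    show "compact_space (ord_interval ?c)" "topspace (ord_interval ?c) \<noteq> {}"
      using compact_Icc_omega1 c by (simp_all add: ord_interval_def compact_space_subtopology)
    show "T f \<in> C_space K" if "f \<in> C_space (ord_interval ?c)" for f
    proof -
      have "continuous_on ?L f"
        using that by (simp add: C_space_def ord_interval_def)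
      then have "continuous_map K euclideanreal (\<lambda>y. (1 / 2) * (E1 f y + E2 f y))"
        using E1(1) E2(1) by (intro continuous_map_real_mult_left continuous_map_add)
      then have "continuous_map K euclideanreal (T f)"
        by (rule continuous_map_eq) (simp add: T_def)
      then show ?thesis
        by (simp add: C_space_def T_def)
    qed
    show "T (\<lambda>x. f x + g x) = (\<lambda>y. T f y + T g y)" for f g
      by (auto simp: T_def E1(2) E2(2) field_simps)
    show "T (\<lambda>x. k * f x) = (\<lambda>y. k * T f y)" for k f
      by (auto simp: T_def E1(3) E2(3) field_simps)
    show "\<bar>T f y\<bar> \<le> M"
      if "\<And>x. x \<in> topspace (ord_interval ?c) \<Longrightarrow> \<bar>f x\<bar> \<le> M" "y \<in> topspace K" for f M y
    proof -
      have "\<bar>E1 f y\<bar> \<le> M" "\<bar>E2 f y\<bar> \<le> M"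
        using that by (auto simp: ord_interval_def intro!: E1(5) E2(5))
      then show ?thesis
        using that(2) by (simp add: T_def)
    qed
    show "\<exists>y\<in>topspace K. \<forall>f\<in>C_space (ord_interval ?c). T f y = (f s + f t) / 2"
      if "s \<in> topspace (ord_interval ?c)" "t \<in> topspace (ord_interval ?c)" for s t
    proof -
      \<comment> \<open>Surjectivity onto the full square makes every pair available, the diagonal
        ones included.\<close>
      have "(s, t) \<in> \<phi> ` C"
        using that by (simp add: C(2) ord_interval_def)
      then obtain y where "y \<in> C" "\<phi> y = (s, t)"
        by auto
      then show ?thesis
        using C_K by (intro bexI[of _ y]) (auto simp: T_def E1(4) E2(4))
    qed
  qed (use assms(1) in auto)
  then show ?thesis
    by blast
qed

end
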